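(* Let $\mathfrak{F}$ be a nonempty set of normalized spectral densities, i.e., $\emptyset\ne\mathfrak{F}\subseteq\mathfrak{F}_{\mathrm{all}}$. Let $T$ be a nonsphericity-corrected F-type test statistic based on $\check\beta$ and $\check\Omega$, where $(\check\beta,\check\Omega,N)$ satisfies the estimator conditions with $N=\emptyset$. Furthermore, assume that $\check\Omega(y)$ is nonnegative definite for every $y\in\mathbb{R}^n$. Suppose there exists a linear subspace $\mathcal{S}$ of $\mathbb{R}^n$ that can be written as $$\mathcal{S}=\mathrm{span}\left(\Pi_{(\mathfrak{M}_0^{lin})^\perp}\left(E_{n,\rho(\gamma_1)}(\gamma_1),\ldots,E_{n,\rho(\gamma_p)}(\gamma_p)\right)\right)\quad\text{for some }\Gamma\in\mathbb{S}(\mathfrak{F},\mathfrak{M}_0^{lin}),$$ where the $\gamma_i$'s denote the elements of $\Gamma$, $p=\mathrm{card}(\Gamma)$, and $\rho(\gamma)=\rho(\gamma,\mathfrak{M}_0^{lin})$, such that $\mathcal{S}$ satisfies $\mathcal{S}\subseteq\mathrm{span}(X)$ (or, equivalently, $\mathrm{span}(E_{n,\rho(\gamma_1)}(\gamma_1),\ldots,E_{n,\rho(\gamma_p)}(\gamma_p))\subseteq\mathrm{span}(X)$). Then $\dim(\mathcal{S})<n-\dim(\mathfrak{M}_0^{lin})$ holds. Furthermore, $$\sup_{f\in\mathfrak{F}}P_{\mu_0,\sigma^2\Sigma(f)}(T\ge C)=1$$ holds for every critical value $C$, $-\infty<C<\infty$, for every $\mu_0\in\mathfrak{M}_0$, and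 for every $\sigma^2\in(0,\infty)$.
   Context: Model: $n,k,q$ are positive integers with $1\le k<n$; $X\in\mathbb{R}^{n\times k}$ is a fixed matrix of rank $k$; $R\in\mathbb{R}^{q\times k}$ has rank $q\ge 1$; $r\in\mathbb{R}^q$. (One tests $R\beta=r$ in $\mathbf{Y}=X\beta+\mathbf{U}$, $\mathbf{U}\sim N(0,\sigma^2\Sigma(f))$, $0<\sigma^2<\infty$, $f\in\mathfrak{F}$.) Here $\mathrm{span}(\cdot)$ is column space, $'$ is transpose, $\Pi_{\mathcal{L}}$ is orthogonal projection onto $\mathcal{L}$, $\mathfrak{M}=\mathrm{span}(X)$, $\mathfrak{M}_0=\{X\beta:R\beta=r\}$, $\mathfrak{M}_0^{lin}=\{X\beta:R\beta=0\}$. $P_{\mu,A}$ is the Gaussian measure on $\mathbb{R}^n$ with mean $\mu$ and covariance $A$; $P(T\ge C)$ means $P(\{y:T(y)\ge C\})$. $\lambda_{\mathbb{R}^n}$ is Lebesgue measure. Spectral densities: $\mathfrak{F}_{\mathrm{all}}$ is the set of all normalized spectral densities of real weakly stationary processes (nonnegative, even, integrable $f$ on $[-\pi,\pi]$ with $\int_{-\pi}^{\pi}f=1$); $\Sigma(f)=\left[\int_{-\pi}^{\pi}e^{-\iota(j-l)\omega}f(\omega)d\omega\right]_{j,l=1}^n$, $\iota$ the imaginary unit. For $\omega\in[0,\pi]$ and integer $s\ge0$, $E_{n,s}(\omega)$ is the $n\times2$ matrix with $j$-th row $(j^s\cos(j\omega),j^s\sin(j\omega))$. For a linear subspace $\mathcal{L}$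 of $\mathbb{R}^n$ with $\dim\mathcal{L}<n$, $\rho(\omega,\mathcal{L})=\min\{s\in\mathbb{N}\cup\{0\}:\mathrm{span}(E_{n,s}(\omega))\nsubseteq\mathcal{L}\}$ (well-defined; positive for at most finitely many $\omega\in[0,\pi]$). Let $\omega_1(\mathcal{L})<\dots<\omega_{p(\mathcal{L})}(\mathcal{L})$ be the elements of $\{\omega\in[0,\pi]:\rho(\omega,\mathcal{L})>0\}$ and $d_i(\mathcal{L})=\rho(\omega_i(\mathcal{L}),\mathcal{L})$, with $p(\mathcal{L})=0$ if this set is empty; $\underline{\omega}(\mathcal{L})$, $\underline{d}(\mathcal{L})$ are the corresponding vectors. Put $\kappa(\omega,d)=2d$ for $\omega\in(0,\pi)$, $\kappa(\omega,d)=d$ for $\omega\in\{0,\pi\}$, and $\kappa(\underline{\omega}(\mathcal{L}),\underline{d}(\mathcal{L}))=\sum_{i=1}^{p(\mathcal{L})}\kappa(\omega_i(\mathcal{L}),d_i(\mathcal{L}))$ (zero if $p(\mathcal{L})=0$). Differencing polynomial: $\Delta_{\underline{\omega}(\mathcal{L}),\underline{d}(\mathcal{L})}(z)=\prod_{i=1}^{p(\mathcal{L})}\Delta_{\omega_i(\mathcal{L})}(z)^{d_i(\mathcal{L})}$ with $\Delta_\omega(z)=1-2\cos(\omega)z+z^2$ for $\omega\in(0,\pi)$ and $\Delta_\omega(z)=1-\cos(\omega)z$ for $\omega\in\{0,\pi\}$ (empty product is $1$). $\mathbb{S}(\mathfrak{F},\mathcal{L})$ is the collection of all $\Gamma\subseteq[0,\pi]$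 satisfying $\sum_{\gamma\in\Gamma}\kappa(\gamma,1)<n-\kappa(\underline{\omega}(\mathcal{L}),\underline{d}(\mathcal{L}))$ for which there is a sequence $f_m\in\mathfrak{F}$ such that the measures on $[-\pi,\pi]$ with densities $g_m(\nu)=|\Delta_{\underline{\omega}(\mathcal{L}),\underline{d}(\mathcal{L})}(e^{\iota\nu})|^2f_m(\nu)/\int_{-\pi}^{\pi}|\Delta_{\underline{\omega}(\mathcal{L}),\underline{d}(\mathcal{L})}(e^{\iota\nu})|^2f_m(\nu)d\nu$ converge weakly to a measure $\mathsf{m}$ with $\mathrm{supp}(\mathsf{m})\cap[0,\pi]=\Gamma$. Estimator conditions on $(\check\beta,\check\Omega,N)$: (i) $\check\beta:\mathbb{R}^n\setminus N\to\mathbb{R}^k$ and $\check\Omega:\mathbb{R}^n\setminus N\to\mathbb{R}^{q\times q}$ are well-defined and continuous on $\mathbb{R}^n\setminus N$, where $N$ is a closed $\lambda_{\mathbb{R}^n}$-null set, and $\check\Omega(y)$ is symmetric for every $y\in\mathbb{R}^n\setminus N$; (ii) $y\in\mathbb{R}^n\setminus N$ implies $\delta y+X\eta\in\mathbb{R}^n\setminus N$ for all $\delta\ne0$, $\eta\in\mathbb{R}^k$; (iii) $\check\beta(\delta y+X\eta)=\delta\check\beta(y)+\eta$ and $\check\Omega(\delta y+X\eta)=\delta^2\check\Omega(y)$ for all $y\in\mathbb{R}^n\setminus N$, $\delta\neq0$, $\eta\in\mathbb{R}^k$; (iv) $\check\Omega$ is $\lambda_{\mathbb{R}^n}$-almost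 everywhere nonsingular on $\mathbb{R}^n\setminus N$. Nonsphericity-corrected F-type test statistic: with $N^*=N\cup\{y\in\mathbb{R}^n\setminus N:\det\check\Omega(y)=0\}$, $T(y)=(R\check\beta(y)-r)'\check\Omega^{-1}(y)(R\check\beta(y)-r)$ for $y\in\mathbb{R}^n\setminus N^*$ and $T(y)=0$ for $y\in N^*$. *)

theory Defs
  imports "HOL-Probability.Probability" "HOL-Computational_Algebra.Polynomial"
begin

text \<open>
  Vectors in \<open>n\<close>-dimensional space have type \<open>real^'n\<close> with \<open>n = CARD('n)\<close>.  The coordinates carry a
  meaning as time points, so the index type is (well-)ordered and its elements are numbered
  \<open>1, \<dots>, n\<close> along that order.
\<close>

definition time :: "'n::{finite,wellorder} \<Rightarrow> real" where
  "time j = real (card {..j})"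

definition orth_proj :: "(real^'n) set \<Rightarrow> real^'n \<Rightarrow> real^'n" where
  "orth_proj L y = (THE p. p \<in> L \<and> y - p \<in> orthogonal_comp L)"

definition null_hyp :: "real^'k^'n \<Rightarrow> real^'k^'q \<Rightarrow> real^'q \<Rightarrow> (real^'n) set" where
  "null_hyp X R r = {X *v \<beta> | \<beta>. R *v \<beta> = r}"

definition null_hyp_lin :: "real^'k^'n \<Rightarrow> real^'k^'q \<Rightarrow> (real^'n) set" where
  "null_hyp_lin X R = {X *v \<beta> | \<beta>. R *v \<beta> = 0}"

definition std_gaussian :: "(real^'n) measure" where
  "std_gaussian = density lborel (\<lambda>z. ennreal (\<Prod>i\<in>UNIV. std_normal_density (z $ i)))"

text \<open>
  The measure with mean \<open>\<mu>\<close> and covariance \<open>A\<close> (symmetric nonnegative definite, possibly singular) is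
  the law of \<open>\<mu> + B Z\<close>, where \<open>Z\<close> is standard Gaussian and \<open>B B' = A\<close>.  Such a \<open>B\<close> exists and, by
  rotation invariance of the standard Gaussian measure, the law does not depend on its choice.
\<close>

definition gaussian :: "real^'n \<Rightarrow> real^'n^'n \<Rightarrow> (real^'n) measure" where
  "gaussian \<mu> A =
     distr std_gaussian borel (\<lambda>z. \<mu> + (SOME B :: real^'n^'n. B ** transpose B = A) *v z)"

text \<open>Values of a spectral density outside \<open>[-\<pi>, \<pi>]\<close> are irrelevant.\<close>

definition spectral_densities :: "(real \<Rightarrow> real) set" where
  "spectral_densities =
     {f. (\<forall>\<omega>\<in>{-pi..pi}. 0 \<le> f \<omega> \<and> f (- \<omega>) = f \<omega>) \<and>
         set_integrable lborel {-pi..pi} f \<and>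
         (LINT \<omega>:{-pi..pi}|lborel. f \<omega>) = 1}"

text \<open>The complex integral below is real since \<open>f\<close> is even; \<open>Re\<close> only changes the type.\<close>

definition Sigma_mat :: "(real \<Rightarrow> real) \<Rightarrow> real^'n::{finite,wellorder}^'n::_" where
  "Sigma_mat f =
     (\<chi> j l. Re (LINT \<omega>:{-pi..pi}|lborel.
        exp (- (\<i> * complex_of_real ((time j - time l) * \<omega>))) * complex_of_real (f \<omega>)))"

definition E_mat :: "nat \<Rightarrow> real \<Rightarrow> real^2^'n::{finite,wellorder}" where
  "E_mat s \<omega> = (\<chi> j. vector [time j ^ s * cos (time j * \<omega>), time j ^ s * sin (time j * \<omega>)])"

definition rho :: "real \<Rightarrow> (real^'n::{finite,wellorder}) set \<Rightarrow> nat" where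
  "rho \<omega> L = (LEAST s. \<not> span (columns (E_mat s \<omega>)) \<subseteq> L)"

text \<open>
  The set of frequencies \<open>\<omega>\<^sub>1(L) < \<dots> < \<omega>\<^sub>p(L)\<close>; the associated orders are \<open>d\<^sub>i(L) = rho (\<omega>\<^sub>i(L)) L\<close>.
  The set is finite whenever \<open>dim L < n\<close>.
\<close>

definition freqs :: "(real^'n::{finite,wellorder}) set \<Rightarrow> real set" where
  "freqs L = {\<omega>\<in>{0..pi}. rho \<omega> L > 0}"

definition kappa :: "real \<Rightarrow> nat \<Rightarrow> nat" where
  "kappa \<omega> d = (if \<omega> \<in> {0<..<pi} then 2 * d else d)"

definition kappa_total :: "(real^'n::{finite,wellorder}) set \<Rightarrow> nat" where
  "kappa_total L = (\<Sum>\<omega>\<in>freqs L. kappa \<omega> (rho \<omega> L))"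

definition Delta :: "real \<Rightarrow> complex poly" where
  "Delta \<omega> = (if \<omega> \<in> {0<..<pi} then [:1, - 2 * complex_of_real (cos \<omega>), 1:]
              else [:1, - complex_of_real (cos \<omega>):])"

definition Delta_total :: "(real^'n::{finite,wellorder}) set \<Rightarrow> complex poly" where
  "Delta_total L = (\<Prod>\<omega>\<in>freqs L. Delta \<omega> ^ rho \<omega> L)"

definition filtered :: "(real^'n::{finite,wellorder}) set \<Rightarrow> (real \<Rightarrow> real) \<Rightarrow> real \<Rightarrow> real" where
  "filtered L f \<nu> = (cmod (poly (Delta_total L) (exp (\<i> * complex_of_real \<nu>))))\<^sup>2 * f \<nu>"

text \<open>Measures on \<open>[-\<pi>, \<pi>]\<close> are represented as Borel measures on the line that vanish outside it.\<close>

definition filtered_measure ::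
    "(real^'n::{finite,wellorder}) set \<Rightarrow> (real \<Rightarrow> real) \<Rightarrow> real measure" where
  "filtered_measure L f =
     density lborel (\<lambda>\<nu>. ennreal (indicator {-pi..pi} \<nu> *
       (filtered L f \<nu> / (LINT \<nu>:{-pi..pi}|lborel. filtered L f \<nu>))))"

definition measure_supp :: "'a::topological_space measure \<Rightarrow> 'a set" where
  "measure_supp M = {x. \<forall>U. open U \<longrightarrow> x \<in> U \<longrightarrow> emeasure M U > 0}"

text \<open>
  An infinite \<open>\<Gamma>\<close> has an infinite \<open>\<kappa>\<close>-sum and is therefore excluded explicitly; the comparison is made
  in \<open>int\<close> to avoid truncated subtraction.
\<close>

definition sing_sets ::
    "(real \<Rightarrow> real) set \<Rightarrow> (real^'n::{finite,wellorder}) set \<Rightarrow> real set set" where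
  "sing_sets F L =
     {\<Gamma>. \<Gamma> \<subseteq> {0..pi} \<and> finite \<Gamma> \<and>
         int (\<Sum>\<gamma>\<in>\<Gamma>. kappa \<gamma> 1) < int CARD('n) - int (kappa_total L) \<and>
         (\<exists>f M. (\<forall>m. f m \<in> F) \<and>
                real_distribution M \<and> emeasure M (- {-pi..pi}) = 0 \<and>
                weak_conv_m (\<lambda>m. filtered_measure L (f m)) M \<and>
                measure_supp M \<inter> {0..pi} = \<Gamma>)}"

definition estimator_conditions ::
    "real^'k^'n \<Rightarrow> (real^'n \<Rightarrow> real^'k) \<Rightarrow> (real^'n \<Rightarrow> real^'q^'q) \<Rightarrow> (real^'n) set \<Rightarrow> bool" where
  "estimator_conditions X bhat Omega N \<longleftrightarrow>
     closed N \<and> N \<in> null_sets lborel \<and>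
     continuous_on (- N) bhat \<and> continuous_on (- N) Omega \<and>
     (\<forall>y. y \<notin> N \<longrightarrow> transpose (Omega y) = Omega y) \<and>
     (\<forall>y \<delta> \<eta>. y \<notin> N \<longrightarrow> \<delta> \<noteq> 0 \<longrightarrow> \<delta> *\<^sub>R y + X *v \<eta> \<notin> N) \<and>
     (\<forall>y \<delta> \<eta>. y \<notin> N \<longrightarrow> \<delta> \<noteq> 0 \<longrightarrow>
        bhat (\<delta> *\<^sub>R y + X *v \<eta>) = \<delta> *\<^sub>R bhat y + \<eta> \<and>
        Omega (\<delta> *\<^sub>R y + X *v \<eta>) = \<delta>\<^sup>2 *\<^sub>R Omega y) \<and>
     (AE y in lborel. y \<notin> N \<longrightarrow> invertible (Omega y))"

definition F_type_stat ::
    "real^'k^'q \<Rightarrow> real^'q \<Rightarrow> (real^'n \<Rightarrow> real^'k) \<Rightarrow> (real^'n \<Rightarrow> real^'q^'q) \<Rightarrow>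
       (real^'n) set \<Rightarrow> real^'n \<Rightarrow> real" where
  "F_type_stat R r bhat Omega N y =
     (if y \<in> N \<union> {y. y \<notin> N \<and> det (Omega y) = 0} then 0
      else (R *v bhat y - r) \<bullet> (matrix_inv (Omega y) *v (R *v bhat y - r)))"

end

theory Submission
  imports Defs "HOL-Computational_Algebra.Fundamental_Theorem_Algebra"
begin

text \<open>
  Let \<open>L\<close> be the linear part of the null hypothesis. For \<open>v\<close> orthogonal to \<open>L\<close> the polynomial
  \<open>V(z) = \<Sum>\<^sub>j v\<^sub>j z\<^sup>j\<close> vanishes at the frequencies of \<open>L\<close> to the orders given by \<open>rho\<close>, hence
  \<open>V = \<Delta> W\<^sub>v\<close> with the differencing polynomial \<open>\<Delta>\<close>. So, up to the normalization \<open>c\<^sub>m\<close> of the filtered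
  measures, \<open>v' \<Sigma>(f\<^sub>m) v\<close> is the integral of \<open>|W\<^sub>v|\<^sup>2\<close> against the filtered measure, and it converges to
  the integral \<open>q(v)\<close> against the weak limit, which is carried by \<open>\<plusminus>\<Gamma>\<close>. If \<open>v\<close> is orthogonal to \<open>S\<close>, the
  orders of the zeros of \<open>V\<close> at \<open>\<plusminus>\<Gamma>\<close> increase by one, so \<open>q(v) = 0\<close>; and \<open>q\<close> does not vanish identically.

  Hence the Gaussian vectors, projected to the complement of \<open>L\<close> and rescaled, concentrate along a
  subsequence on \<open>S \<subseteq> span X\<close> without charging \<open>0\<close>. The statistic is invariant under this projection and
  rescaling about the null mean. On \<open>span X\<close> equivariance forces \<open>Omega\<close> to vanish, while \<open>R \<beta> - r\<close>
  does not vanish at such limits. As \<open>Omega\<close> is nonnegative definite and almost surely nonsingular, the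
  statistic tends to infinity almost surely along the subsequence.
\<close>

section \<open>Linear algebra and Gaussian measures\<close>

lemma quadform_add:
  fixes A :: "real^'n^'n"
  assumes "transpose A = A"
  shows "(x + t *\<^sub>R y) \<bullet> (A *v (x + t *\<^sub>R y)) = x \<bullet> (A *v x) + 2 * t * (x \<bullet> (A *v y)) + t\<^sup>2 * (y \<bullet> (A *v y))"
proof -
  have "y \<bullet> (A *v x) = x \<bullet> (A *v y)"
    using assms by (metis dot_lmul_matrix inner_commute transpose_matrix_vector)
  then show ?thesis
    by (simp add: matrix_vector_right_distrib matrix_vector_mult_scaleR algebra_simps power2_eq_square)
qed

text \<open>The quadratic \<open>t\<close> -> form at \<open>x + t y\<close> is nonnegative, which
  bounds its discriminant. Since the form may be degenerate, a vanishing leading coefficient is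
  treated apart.\<close>

lemma psd_Cauchy_Schwarz:
  fixes A :: "real^'n^'n"
  assumes sym: "transpose A = A" and psd: "\<And>x. 0 \<le> x \<bullet> (A *v x)"
  shows "(x \<bullet> (A *v y))\<^sup>2 \<le> (x \<bullet> (A *v x)) * (y \<bullet> (A *v y))"
proof -
  define a b c where "a = x \<bullet> (A *v x)" and "b = x \<bullet> (A *v y)" and "c = y \<bullet> (A *v y)"
  have q: "0 \<le> a + 2 * t * b + t\<^sup>2 * c" for t
    using psd[of "x + t *\<^sub>R y"] unfolding quadform_add[OF sym] a_def b_def c_def .
  have "c \<ge> 0" unfolding c_def by (rule psd)
  show ?thesis
  proof (cases "c = 0")
    case True
    have "b = 0"
    proof (rule ccontr)
      assume "b \<noteq> 0"
      \<comment> \<open>With \<open>c = 0\<close> the quadratic is affine in \<open>t\<close>, and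
        this choice gives it the value -1.\<close>
      then show False using q[of "- (a + 1) / (2 * b)"] True by (simp add: field_simps)
    qed
    then show ?thesis using True by (simp add: a_def b_def c_def)
  next
    case False
    then have "c > 0" using \<open>c \<ge> 0\<close> by simp
    \<comment> \<open>The point \<open>- b / c\<close> is the minimizer of the quadratic.\<close>
    have "0 \<le> a + 2 * (- b / c) * b + (- b / c)\<^sup>2 * c" by (rule q)
    also have "\<dots> = a - b\<^sup>2 / c"
      using \<open>c > 0\<close> by (simp add: field_simps power2_eq_square)
    finally have "b\<^sup>2 \<le> a * c" using \<open>c > 0\<close> by (simp add: field_simps)
    then show ?thesis by (simp add: a_def b_def c_def)
  qed
qed

lemma quadform_axis: "axis i 1 \<bullet> (A *v axis j 1) = A $ i $ j" for A :: "real^'n^'n"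
  by (simp add: matrix_vector_mult_basis column_def inner_axis inner_commute[of "axis i 1"])

text \<open>One elimination step of the Cholesky decomposition: the Schur complement of a diagonal entry is
  again nonnegative definite, by Cauchy-Schwarz.\<close>

lemma psd_factor_step:
  fixes A :: "real^'n^'n"
  assumes "finite J" "transpose A = A" "\<And>x. 0 \<le> x \<bullet> (A *v x)" "\<And>i. i \<notin> J \<Longrightarrow> A $ i = 0"
  shows "\<exists>u. A = (\<chi> a b. \<Sum>i\<in>J. u i $ a * u i $ b)"
  using assms
proof (induction J arbitrary: A rule: finite_induct)
  case empty
  then show ?case by (auto simp: vec_eq_iff)
next
  case (insert i J)
  \<comment> \<open>Column \<open>i\<close> divided by the root of its pivot, so that subtracting
    \<open>w w'\<close> clears row \<open>i\<close>. A zero pivot needs no subtraction, since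
    Cauchy-Schwarz then forces the whole row to be zero already.\<close>
  define w where "w = (if A$i$i = 0 then 0 else (1 / sqrt (A$i$i)) *\<^sub>R (A *v axis i 1))"
  define A' where "A' = (\<chi> a b. A$a$b - w$a * w$b)"
  have dpos: "0 \<le> A$i$i" using insert.prems(2)[of "axis i 1"] by (simp add: quadform_axis)
  have symA: "A$a$b = A$b$a" for a b
    using insert.prems(1) by (metis (no_types, lifting) transpose_def vec_lambda_beta)
  have sym': "transpose A' = A'"
    using symA by (simp add: A'_def transpose_def vec_eq_iff mult.commute)
  have quad': "x \<bullet> (A' *v x) = x \<bullet> (A *v x) - (x \<bullet> w)\<^sup>2" for x
    by (simp add: A'_def inner_vec_def matrix_vector_mult_def power2_eq_square sum_product
        sum_distrib_left sum_distrib_right sum_subtractf algebra_simps)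
  have w_a: "w $ a = (if A$i$i = 0 then 0 else A$a$i / sqrt (A$i$i))" for a
    by (simp add: w_def matrix_vector_mult_basis column_def)
  have CS: "(x \<bullet> (A *v axis i 1))\<^sup>2 \<le> (x \<bullet> (A *v x)) * A$i$i" for x
    using psd_Cauchy_Schwarz[OF insert.prems(1,2), of x "axis i 1"] by (simp add: quadform_axis)
  have psd': "0 \<le> x \<bullet> (A' *v x)" for x
  proof (cases "A$i$i = 0")
    case True
    then show ?thesis using insert.prems(2)[of x] by (simp add: quad' w_def)
  next
    case False
    have "(x \<bullet> w)\<^sup>2 = (x \<bullet> (A *v axis i 1))\<^sup>2 / A$i$i"
      using False dpos by (simp add: w_def power_divide)
    also have "\<dots> \<le> x \<bullet> (A *v x)"
      using CS[of x] False dpos by (simp add: divide_le_eq)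
    finally show ?thesis by (simp add: quad')
  qed
  have row: "A' $ j = 0" if "j \<notin> J" for j
  proof (cases "j = i")
    case True
    have "A$i$b - w$i * w$b = 0" for b
    proof (cases "A$i$i = 0")
      case True
      then show ?thesis using CS[of "axis b 1"] by (simp add: quadform_axis symA[of i b] w_a)
    next
      case False
      then show ?thesis using dpos by (simp add: symA[of i b] w_a real_div_sqrt)
    qed
    then show ?thesis using True by (simp add: A'_def vec_eq_iff)
  next
    case False
    then have "A$j = 0" using insert.prems(3) that by auto
    then show ?thesis by (simp add: A'_def vec_eq_iff w_a)
  qed
  obtain u where u: "A' = (\<chi> a b. \<Sum>i\<in>J. u i $ a * u i $ b)"
    using insert.IH[OF sym' psd' row] by blast
  have "A $ a $ b = w$a * w$b + (\<Sum>j\<in>J. u j $ a * u j $ b)" for a b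
    using arg_cong[OF u, of "\<lambda>M. M$a$b"] by (simp add: A'_def)
  then have "A = (\<chi> a b. \<Sum>j\<in>insert i J. (u(i := w)) j $ a * (u(i := w)) j $ b)"
    using insert.hyps by (auto simp: vec_eq_iff intro!: sum.cong)
  then show ?case by blast
qed

text \<open>Ensures that the choice of \<open>B\<close> in \<open>gaussian\<close> is a genuine
  factor. The rank-one vectors of the elimination become the columns of \<open>B\<close>.\<close>

lemma psd_factor:
  fixes A :: "real^'n^'n"
  assumes "transpose A = A" "\<And>x. 0 \<le> x \<bullet> (A *v x)"
  shows "\<exists>B :: real^'n^'n. B ** transpose B = A"
proof -
  have "\<exists>u :: 'n \<Rightarrow> real^'n. A = (\<chi> a b. \<Sum>i\<in>UNIV. u i $ a * u i $ b)"
    by (rule psd_factor_step[OF _ assms]) auto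
  then obtain u :: "'n \<Rightarrow> real^'n" where "A = (\<chi> a b. \<Sum>i\<in>UNIV. u i $ a * u i $ b)" ..
  then have "(\<chi> a i. u i $ a) ** transpose (\<chi> a i. u i $ a) = A"
    by (simp add: matrix_matrix_mult_def transpose_def)
  then show ?thesis ..
qed

lemma norm_transpose_mult:
  fixes B :: "real^'n^'m"
  shows "v \<bullet> ((B ** transpose B) *v v) = (norm (transpose B *v v))\<^sup>2"
proof -
  have "v \<bullet> ((B ** transpose B) *v v) = v \<bullet> (B *v (transpose B *v v))"
    by (simp only: matrix_vector_mul_assoc)
  also have "\<dots> = (v v* B) \<bullet> (transpose B *v v)"
    by (rule dot_lmul_matrix[symmetric])
  finally show ?thesis by (simp add: power2_norm_eq_inner transpose_matrix_vector)
qed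

section \<open>Orthogonal projections\<close>

lemma orth_proj_eqI:
  assumes "subspace L" "p \<in> L" "y - p \<in> orthogonal_comp L"
  shows "orth_proj L y = p"
  unfolding orth_proj_def
proof (rule the_equality)
  show "p \<in> L \<and> y - p \<in> orthogonal_comp L" using assms by simp
  fix p' assume p': "p' \<in> L \<and> y - p' \<in> orthogonal_comp L"
  have "p - p' \<in> L" using assms p' by (simp add: subspace_diff)
  moreover have "(y - p') - (y - p) \<in> orthogonal_comp L"
    by (rule subspace_diff[OF subspace_orthogonal_comp p'[THEN conjunct2] assms(3)])
  then have "p - p' \<in> orthogonal_comp L" by simp
  ultimately have "orthogonal (p - p') (p - p')"
    by (simp add: orthogonal_comp_def)
  then show "p' = p" by (simp add: orthogonal_self)
qed

lemma orth_proj_exists: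
  fixes y :: "real^'n"
  assumes "subspace L"
  obtains p where "p \<in> L" "y - p \<in> orthogonal_comp L"
proof -
  obtain p z where "p \<in> span L" "\<And>w. w \<in> span L \<Longrightarrow> orthogonal z w" "y = p + z"
    using orthogonal_subspace_decomp_exists[of L y] by blast
  moreover have "span L = L" using assms by (simp add: span_eq_iff)
  ultimately show thesis using that[of p]
    by (simp add: orthogonal_comp_def orthogonal_commute)
qed

lemma orth_proj_comp:
  fixes y :: "real^'n"
  assumes "subspace L"
  shows "orth_proj (orthogonal_comp L) y \<in> orthogonal_comp L"
    and "y - orth_proj (orthogonal_comp L) y \<in> L"
proof -
  obtain p where "p \<in> orthogonal_comp L" "y - p \<in> orthogonal_comp (orthogonal_comp L)"
    using orth_proj_exists[OF subspace_orthogonal_comp] .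
  then have "p \<in> orthogonal_comp L" "y - p \<in> L" "orth_proj (orthogonal_comp L) y = p"
    using orth_proj_eqI[OF subspace_orthogonal_comp] orthogonal_comp_self[OF assms] by auto
  then show "orth_proj (orthogonal_comp L) y \<in> orthogonal_comp L"
    and "y - orth_proj (orthogonal_comp L) y \<in> L" by auto
qed

lemma linear_orth_proj_comp:
  fixes L :: "(real^'n) set"
  assumes "subspace L"
  shows "linear (orth_proj (orthogonal_comp L))"
proof (rule linearI)
  note P = orth_proj_comp[OF assms] and LL = orthogonal_comp_self[OF assms]
  show "orth_proj (orthogonal_comp L) (x + y)
      = orth_proj (orthogonal_comp L) x + orth_proj (orthogonal_comp L) y" for x y
  proof (rule orth_proj_eqI)
    show "orth_proj (orthogonal_comp L) x + orth_proj (orthogonal_comp L) y \<in> orthogonal_comp L"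
      by (intro subspace_add subspace_orthogonal_comp P)
    have "(x - orth_proj (orthogonal_comp L) x) + (y - orth_proj (orthogonal_comp L) y) \<in> L"
      by (intro subspace_add assms P)
    then show "x + y - (orth_proj (orthogonal_comp L) x + orth_proj (orthogonal_comp L) y)
        \<in> orthogonal_comp (orthogonal_comp L)" unfolding LL by (simp add: algebra_simps)
  qed (rule subspace_orthogonal_comp)
  show "orth_proj (orthogonal_comp L) (c *\<^sub>R x) = c *\<^sub>R orth_proj (orthogonal_comp L) x" for c x
  proof (rule orth_proj_eqI)
    show "c *\<^sub>R orth_proj (orthogonal_comp L) x \<in> orthogonal_comp L"
      by (intro subspace_scale subspace_orthogonal_comp P)
    have "c *\<^sub>R (x - orth_proj (orthogonal_comp L) x) \<in> L"
      by (intro subspace_scale assms P)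
    then show "c *\<^sub>R x - c *\<^sub>R orth_proj (orthogonal_comp L) x
        \<in> orthogonal_comp (orthogonal_comp L)" unfolding LL by (simp add: algebra_simps)
  qed (rule subspace_orthogonal_comp)
qed

lemma orth_proj_comp_inner:
  fixes L :: "(real^'n) set"
  assumes "subspace L"
  shows "orth_proj (orthogonal_comp L) x \<bullet> y = x \<bullet> orth_proj (orthogonal_comp L) y"
proof -
  note P = orth_proj_comp[OF assms]
  have "orth_proj (orthogonal_comp L) x \<bullet> (y - orth_proj (orthogonal_comp L) y) = 0"
       "(x - orth_proj (orthogonal_comp L) x) \<bullet> orth_proj (orthogonal_comp L) y = 0"
    using P[of x] P[of y] by (auto simp: orthogonal_comp_def orthogonal_def inner_commute)
  then show ?thesis by (simp add: inner_diff_left inner_diff_right)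
qed

section \<open>The standard Gaussian measure and its null sets\<close>

lemma std_gaussian_eq_prod:
  "(\<Prod>i\<in>UNIV. std_normal_density (z $ i)) = (\<Prod>b\<in>Basis. std_normal_density (z \<bullet> b))" for z :: "real^'n"
proof -
  have B: "Basis = range (\<lambda>i::'n. axis i (1::real))" by (auto simp: Basis_vec_def)
  have "inj (\<lambda>i::'n. axis i (1::real))" by (auto simp: inj_def axis_eq_axis)
  then show ?thesis unfolding B by (simp add: prod.reindex inner_axis)
qed

lemma prob_space_std_gaussian: "prob_space (std_gaussian :: (real^'n) measure)"
proof (rule prob_spaceI)
  have "emeasure (std_gaussian :: (real^'n) measure) (space std_gaussian) =
      (\<integral>\<^sup>+z. (\<Prod>b\<in>Basis. ennreal (std_normal_density (z \<bullet> b))) \<partial>(lborel :: (real^'n) measure))"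
    unfolding std_gaussian_def std_gaussian_eq_prod
    by (subst emeasure_density) (auto simp: prod_ennreal)
  also have "\<dots> = (\<Prod>b\<in>(Basis::(real^'n) set). (\<integral>\<^sup>+x. ennreal (std_normal_density x) \<partial>lborel))"
    by (subst nn_integral_lborel_prod) auto
  also have "(\<integral>\<^sup>+x. ennreal (std_normal_density x) \<partial>lborel) = 1"
    using prob_space.emeasure_space_1[OF prob_space_normal_density[of 1 0]]
    by (simp add: emeasure_density)
  finally show "emeasure (std_gaussian :: (real^'n) measure) (space std_gaussian) = 1" by simp
qed

lemma sets_std_gaussian [simp, measurable_cong]: "sets std_gaussian = sets borel"
  by (simp add: std_gaussian_def)

lemma AE_std_gaussianI: "AE z in lborel. P z \<Longrightarrow> AE z in std_gaussian. P (z :: real^'n)"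
proof -
  assume "AE z in lborel. P z"
  then show ?thesis unfolding std_gaussian_def
    by (subst AE_density) (auto simp: std_gaussian_eq_prod)
qed

text \<open>The kernel of a nonzero matrix is a proper subspace, hence Lebesgue null. This keeps the
  limiting Gaussian vector away from 0.\<close>

lemma AE_std_gaussian_mult_ne_0:
  fixes D :: "real^'n^'n"
  assumes "D \<noteq> 0"
  shows "AE z in std_gaussian. D *v z \<noteq> 0"
proof (rule AE_std_gaussianI)
  have sub: "subspace {z. D *v z = 0}"
    by (auto simp: subspace_def matrix_vector_right_distrib matrix_vector_mult_scaleR)
  have "{z. D *v z = 0} \<noteq> UNIV"
  proof
    assume "{z. D *v z = 0} = UNIV"
    then have "D *v axis i 1 = 0" for i by auto
    then have "D $ a $ i = 0" for a i
      by (metis column_def matrix_vector_mult_basis vec_lambda_beta zero_index)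
    then show False using assms by (simp add: vec_eq_iff)
  qed
  then have "dim {z. D *v z = 0} < DIM(real^'n)"
    using sub by (metis dim_eq_full dim_subset_UNIV le_neq_implies_less span_eq_iff)
  then have "negligible {z. D *v z = 0}" by (rule negligible_lowdim)
  moreover have "closed {z. D *v z = 0}" using sub by (rule closed_subspace)
  ultimately have "{z. D *v z = 0} \<in> null_sets lborel"
    by (simp add: negligible_iff_null_sets null_sets_completion_iff)
  from AE_not_in[OF this] show "AE z in lborel. D *v z \<noteq> 0" by simp
qed

text \<open>The preimage of \<open>N\<close> is its image under the inverse affine map, and
  differentiable maps preserve negligible sets. Closedness makes the preimage Borel, so that
  negligibility turns into nullity for \<open>lborel\<close>.\<close>

lemma AE_std_gaussian_affine:
  fixes B :: "real^'n^'n"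
  assumes inv: "invertible B" and cl: "closed N" and null: "AE y in lborel. y \<notin> N"
  shows "AE z in std_gaussian. \<mu> + B *v z \<notin> N"
proof (rule AE_std_gaussianI)
  have N: "N \<in> null_sets lborel"
    using null cl by (subst AE_iff_null_sets) auto
  obtain B' where B': "B ** B' = mat 1" "B' ** B = mat 1" using inv by (auto simp: invertible_def)
  have eq: "{z. \<mu> + B *v z \<in> N} = (\<lambda>y. B' *v (y - \<mu>)) ` N"
  proof (intro set_eqI iffI)
    fix z assume "z \<in> {z. \<mu> + B *v z \<in> N}"
    moreover have "z = B' *v ((\<mu> + B *v z) - \<mu>)"
      by (simp add: matrix_vector_mul_assoc B')
    ultimately show "z \<in> (\<lambda>y. B' *v (y - \<mu>)) ` N" by blast
  next
    fix z assume "z \<in> (\<lambda>y. B' *v (y - \<mu>)) ` N"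
    then show "z \<in> {z. \<mu> + B *v z \<in> N}" by (auto simp: matrix_vector_mul_assoc B')
  qed
  have "negligible N" using N by (simp add: negligible_iff_null_sets null_sets_completionI)
  moreover have "(\<lambda>y. B' *v (y - \<mu>)) differentiable_on N"
    unfolding matrix_vector_mult_diff_distrib
    by (rule differentiable_on_diff[OF linear_imp_differentiable_on differentiable_on_const]) simp
  ultimately have "negligible ((\<lambda>y. B' *v (y - \<mu>)) ` N)"
    by (intro negligible_differentiable_image_negligible) auto
  moreover have "closed {z. \<mu> + B *v z \<in> N}"
    using closed_vimage[OF cl, of "\<lambda>z. \<mu> + B *v z"]
    by (simp add: vimage_def continuous_on_add matrix_vector_mult_linear_continuous_on)
  ultimately have "{z. \<mu> + B *v z \<in> N} \<in> null_sets lborel"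
    by (simp add: eq negligible_iff_null_sets null_sets_completion_iff)
  from AE_not_in[OF this] show "AE z in lborel. \<mu> + B *v z \<notin> N" by simp
qed

section \<open>Trigonometric polynomials and the differencing polynomial\<close>

text \<open>The natural-number counterpart of \<open>time\<close>, so that time points can serve as
  exponents of monomials.\<close>

definition index :: "'n::{finite,wellorder} \<Rightarrow> nat" where
  "index j = card {..j}"

definition tpoly :: "real^'n::{finite,wellorder} \<Rightarrow> complex poly" where
  "tpoly v = (\<Sum>j\<in>UNIV. monom (of_real (v $ j)) (index j))"

text \<open>The Euler operator z d/dz. Monomials are its eigenvectors with the exponent as
  eigenvalue, so its \<open>s\<close>-th iterate produces the factors \<open>time j ^ s\<close> of
  \<open>E_mat\<close>, which ordinary derivatives would not.\<close>

definition euler_op :: "complex poly \<Rightarrow> complex poly" where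
  "euler_op p = [:0, 1:] * pderiv p"

lemma time_eq_index: "time j = real (index j)"
  by (simp add: time_def index_def)

lemma inj_index: "inj (index :: 'n::{finite,wellorder} \<Rightarrow> nat)"
proof (rule linorder_injI)
  fix x y :: 'n assume "x < y"
  then have "{..x} \<subset> {..y}" by auto
  then have "card {..x} < card {..y}" by (intro psubset_card_mono) auto
  then show "index x \<noteq> index y" by (simp add: index_def)
qed

lemma coeff_tpoly: "coeff (tpoly v) (index j) = of_real (v $ j)"
proof -
  have "coeff (tpoly v) (index j) = (\<Sum>i\<in>UNIV. if i = j then of_real (v $ i) else 0)"
    unfolding tpoly_def coeff_sum by (intro sum.cong) (auto simp: inj_eq[OF inj_index])
  then show ?thesis by simp
qed

lemma tpoly_eq_0_iff: "tpoly v = 0 \<longleftrightarrow> v = 0"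
proof
  assume "tpoly v = 0"
  then have "of_real (v $ j) = (0 :: complex)" for j by (metis coeff_tpoly coeff_0)
  then show "v = 0" by (simp add: vec_eq_iff)
qed (simp add: tpoly_def)

lemma poly_tpoly_cis: "poly (tpoly v) (cis \<omega>) = (\<Sum>j\<in>UNIV. of_real (v $ j) * cis (time j * \<omega>))"
  by (simp add: tpoly_def poly_sum poly_monom time_eq_index Complex.DeMoivre)

lemma euler_op_monom: "euler_op (monom c n) = monom (of_nat n * c) n"
  unfolding euler_op_def pderiv_monom
  by (cases n) (auto simp: monom_altdef)

lemma euler_op_add: "euler_op (p + q) = euler_op p + euler_op q"
  by (simp add: euler_op_def pderiv_add algebra_simps)

lemma euler_op_sum: "euler_op (\<Sum>i\<in>I. f i) = (\<Sum>i\<in>I. euler_op (f i))"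
  by (induction I rule: infinite_finite_induct) (auto simp: euler_op_add, simp_all add: euler_op_def)

lemma euler_op_power_tpoly:
  "(euler_op ^^ s) (tpoly v) = (\<Sum>j\<in>UNIV. monom (of_real (v $ j * time j ^ s)) (index j))"
  by (induction s) (simp_all add: tpoly_def euler_op_sum euler_op_monom time_eq_index mult_ac)

text \<open>Bridge between geometry and zeros: orthogonality to the columns of
  \<open>E_mat s \<omega>\<close> becomes the vanishing of an iterated Euler derivative on the unit
  circle.\<close>

lemma poly_euler_op_power_tpoly:
  "poly ((euler_op ^^ s) (tpoly v)) (cis \<omega>) =
     Complex (v \<bullet> column 1 (E_mat s \<omega>)) (v \<bullet> column 2 (E_mat s \<omega>))"
  by (simp add: euler_op_power_tpoly poly_sum poly_monom Complex.DeMoivre complex_eq_iff inner_vec_def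
      column_def E_mat_def vector_2 time_eq_index[symmetric] mult_ac)

lemma poly_euler_op_power_tpoly_minus:
  "poly ((euler_op ^^ s) (tpoly v)) (cis (- \<omega>)) = cnj (poly ((euler_op ^^ s) (tpoly v)) (cis \<omega>))"
  unfolding poly_euler_op_power_tpoly
  by (simp add: complex_eq_iff inner_vec_def column_def E_mat_def vector_2 sum_negf)

lemma poly_euler_op_tpoly_eq_0_iff:
  fixes v :: "real^'n::{finite,wellorder}"
  shows "poly ((euler_op ^^ s) (tpoly v)) (cis \<omega>) = 0 \<longleftrightarrow> (\<forall>c\<in>columns (E_mat s \<omega>). v \<bullet> c = 0)"
  proof -
  have "columns (E_mat s \<omega> :: real^2^'n::_) = (\<lambda>i. column i (E_mat s \<omega>)) ` {1, 2}"
    by (auto simp: columns_def image_def) (metis exhaust_2)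
  then have "(\<forall>c\<in>columns (E_mat s \<omega>). v \<bullet> c = 0) \<longleftrightarrow>
      v \<bullet> column 1 (E_mat s \<omega>) = 0 \<and> v \<bullet> column 2 (E_mat s \<omega>) = 0"
    by simp
  then show ?thesis unfolding poly_euler_op_power_tpoly by (simp add: complex_eq_iff inner_commute)
qed

text \<open>Away from the origin the factor z has no zero, so \<open>euler_op\<close> lowers the
  order of a root by exactly one, just as \<open>pderiv\<close> does.\<close>

lemma le_order_iff_euler_op:
  assumes "p \<noteq> 0" "z \<noteq> 0"
  shows "d \<le> order z p \<longleftrightarrow> (\<forall>s<d. poly ((euler_op ^^ s) p) z = 0)"
  using assms(1)
proof (induction d arbitrary: p)
  case (Suc d)
  show ?case
  proof (cases "poly p z = 0")
    case True
    then have ord: "order z p \<noteq> 0" using Suc.prems by (simp add: order_root)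
    \<comment> \<open>A nonzero polynomial with a root has positive degree, so in characteristic
      zero its derivative is nonzero.\<close>
    have "pderiv p \<noteq> 0"
      using ord order_degree[OF Suc.prems, of z] by (simp add: pderiv_eq_0_iff)
    then have eq: "order z p = Suc (order z (euler_op p))" and nz: "euler_op p \<noteq> 0"
      using order_pderiv[OF Suc.prems True] \<open>z \<noteq> 0\<close>
      by (auto simp: euler_op_def order_mult order_0I simp del: mult_pCons_left)
    have "(\<forall>s<Suc d. poly ((euler_op ^^ s) p) z = 0) \<longleftrightarrow> (\<forall>s<d. poly ((euler_op ^^ s) (euler_op p)) z = 0)"
      using True by (simp add: All_less_Suc2 funpow_Suc_right del: funpow.simps)
    then show ?thesis using Suc.IH[OF nz] eq by simp
  next
    case False
    then have "order z p = 0" by (rule order_0I)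
    then show ?thesis using False by (auto intro!: exI[of _ 0])
  qed
qed simp

text \<open>The coefficients are real, so conjugate points are zeros of equal order.\<close>

lemma order_tpoly_minus:
  assumes "v \<noteq> 0"
  shows "order (cis (- \<omega>)) (tpoly v) = order (cis \<omega>) (tpoly v)"
proof -
  have "d \<le> order (cis (- \<omega>)) (tpoly v) \<longleftrightarrow> d \<le> order (cis \<omega>) (tpoly v)" for d
    using assms by (simp add: le_order_iff_euler_op tpoly_eq_0_iff poly_euler_op_power_tpoly_minus)
  then show ?thesis by (metis le_antisym order_refl)
qed

lemma le_order_tpoly_iff:
  assumes "v \<noteq> 0"
  shows "d \<le> order (cis \<omega>) (tpoly v) \<longleftrightarrow> (\<forall>s<d. \<forall>c\<in>columns (E_mat s \<omega>). v \<bullet> c = 0)"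
  using assms by (simp add: le_order_iff_euler_op tpoly_eq_0_iff poly_euler_op_tpoly_eq_0_iff)

section \<open>The orders \<open>rho\<close> as minimal orders of zeros\<close>

lemma columns_subset_of_less_rho:
  "s < rho \<omega> L \<Longrightarrow> columns (E_mat s \<omega>) \<subseteq> L"
  unfolding rho_def using not_less_Least span_superset by blast

lemma rho_le_order_tpoly:
  assumes "v \<in> orthogonal_comp L" "v \<noteq> 0"
  shows "rho \<omega> L \<le> order (cis \<omega>) (tpoly v)"
  unfolding le_order_tpoly_iff[OF assms(2)]
  using columns_subset_of_less_rho[of _ \<omega> L] assms(1)
  by (fastforce simp: orthogonal_comp_def orthogonal_def inner_commute)

lemma orthogonal_comp_nontrivial:
  fixes L :: "(real^'n) set"
  assumes "subspace L" "L \<noteq> UNIV"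
  obtains v where "v \<in> orthogonal_comp L" "v \<noteq> 0"
proof -
  have "orthogonal_comp L \<noteq> {0}"
    using orthogonal_comp_self[OF assms(1)] assms(2) by auto
  then show thesis using that subspace_0[OF subspace_orthogonal_comp, of L] by blast
qed

text \<open>If the columns lay in \<open>L\<close> for every \<open>s\<close>, a nonzero
  \<open>v\<close> orthogonal to \<open>L\<close> would yield a nonzero polynomial with a zero of
  infinite order. Thus \<open>LEAST\<close> in \<open>rho\<close> is attained.\<close>

lemma exists_rho:
  fixes L :: "(real^'n::{finite,wellorder}) set"
  assumes "subspace L" "L \<noteq> UNIV"
  shows "\<not> span (columns (E_mat (rho \<omega> L) \<omega>)) \<subseteq> L"
proof -
  have "\<exists>s. \<not> span (columns (E_mat s \<omega>)) \<subseteq> L"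
  proof (rule ccontr)
    assume "\<not> ?thesis"
    then have sub: "columns (E_mat s \<omega>) \<subseteq> L" for s using span_superset by blast
    obtain v where v: "v \<in> orthogonal_comp L" "v \<noteq> 0"
      using orthogonal_comp_nontrivial[OF assms] .
    have "Suc (order (cis \<omega>) (tpoly v)) \<le> order (cis \<omega>) (tpoly v)"
      unfolding le_order_tpoly_iff[OF v(2)] using v(1) sub
      by (fastforce simp: orthogonal_comp_def orthogonal_def inner_commute)
    then show False by simp
  qed
  then show ?thesis unfolding rho_def by (rule LeastI_ex)
qed

text \<open>Some column \<open>c\<close> of order \<open>rho\<close> escapes \<open>L\<close>. Its
  component \<open>v\<close> orthogonal to \<open>L\<close> satisfies v . c = v . v, which is
  nonzero, so the zero of \<open>tpoly v\<close> has no higher order.\<close>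

lemma rho_eq_order_tpoly:
  fixes L :: "(real^'n::{finite,wellorder}) set"
  assumes "subspace L" "L \<noteq> UNIV"
  obtains v where "v \<in> orthogonal_comp L" "v \<noteq> 0" "order (cis \<omega>) (tpoly v) = rho \<omega> L"
proof -
  obtain c where c: "c \<in> columns (E_mat (rho \<omega> L) \<omega>)" "c \<notin> L"
    using exists_rho[OF assms, of \<omega>] span_minimal[OF _ assms(1)] by blast
  define v where "v = orth_proj (orthogonal_comp L) c"
  have v: "v \<in> orthogonal_comp L" "c - v \<in> L"
    using orth_proj_comp[OF assms(1)] by (auto simp: v_def)
  have "v \<noteq> 0" using v c by auto
  have "v \<bullet> (c - v) = 0" using v by (auto simp: orthogonal_comp_def orthogonal_def inner_commute)
  then have "v \<bullet> c \<noteq> 0" using \<open>v \<noteq> 0\<close> by (simp add: inner_diff_right)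
  then have "\<not> Suc (rho \<omega> L) \<le> order (cis \<omega>) (tpoly v)"
    unfolding le_order_tpoly_iff[OF \<open>v \<noteq> 0\<close>] using c by blast
  with rho_le_order_tpoly[OF v(1) \<open>v \<noteq> 0\<close>, of \<omega>] have "order (cis \<omega>) (tpoly v) = rho \<omega> L" by simp
  then show thesis using that v(1) \<open>v \<noteq> 0\<close> by blast
qed

lemma cis_inj_on: "inj_on cis {0..pi}"
proof (rule inj_onI)
  fix x y assume "x \<in> {0..pi}" "y \<in> {0..pi}" "cis x = cis y"
  then show "x = y" using cos_inj_pi[of x y] by (auto simp: complex_eq_iff)
qed

text \<open>For one fixed nonzero \<open>v\<close> orthogonal to \<open>L\<close>, every such
  frequency gives a root of \<open>tpoly v\<close>, and \<open>cis\<close> is injective on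
  [0, pi].\<close>

lemma finite_freqs:
  fixes L :: "(real^'n::{finite,wellorder}) set"
  assumes "subspace L" "L \<noteq> UNIV"
  shows "finite (freqs L)"
proof -
  obtain v where v: "v \<in> orthogonal_comp L" "v \<noteq> 0"
    using orthogonal_comp_nontrivial[OF assms] .
  have "poly (tpoly v) (cis \<omega>) = 0" if "\<omega> \<in> freqs L" for \<omega>
    using rho_le_order_tpoly[OF v, of \<omega>] that order_root[of "tpoly v" "cis \<omega>"]
    by (auto simp: freqs_def)
  then have "cis ` freqs L \<subseteq> {z. poly (tpoly v) z = 0}" by auto
  then have "finite (cis ` freqs L)"
    using poly_roots_finite[of "tpoly v"] v tpoly_eq_0_iff finite_subset by blast
  moreover have "inj_on cis (freqs L)"
    by (rule inj_on_subset[OF cis_inj_on]) (auto simp: freqs_def)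
  ultimately show ?thesis by (rule finite_imageD)
qed

section \<open>Zeros of the differencing polynomial\<close>

lemma Delta_nonzero: "Delta \<omega> \<noteq> 0"
  by (simp add: Delta_def)

lemma cis_mult_minus: "cis x * cis (- x) = 1"
  by (simp add: cis_mult)

lemma order_linear: "order z [:- a, 1 :: complex:] = (if z = a then 1 else 0)"
  using order_power_n_n[of a 1] by (auto intro!: order_0I)

text \<open>An interior frequency gives two distinct conjugate simple roots. At 0 and pi these
  coincide, and \<open>Delta\<close> is linear there, so the root stays simple.\<close>

lemma order_Delta:
  assumes "\<omega> \<in> {0..pi}"
  shows "order z (Delta \<omega>) = (if z = cis \<omega> \<or> z = cis (- \<omega>) then 1 else 0)"
proof (cases "\<omega> \<in> {0<..<pi}")
  case True
  have "sin \<omega> \<noteq> 0" using sin_gt_zero[of \<omega>] True by auto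
  then have ne: "cis \<omega> \<noteq> cis (- \<omega>)" by (auto simp: complex_eq_iff)
  have "cis \<omega> + cis (- \<omega>) = 2 * of_real (cos \<omega>)" by (simp add: complex_eq_iff)
  then have "Delta \<omega> = [:- cis \<omega>, 1:] * [:- cis (- \<omega>), 1:]"
    using True cis_mult_minus[of \<omega>] by (simp add: Delta_def algebra_simps)
  then have "order z (Delta \<omega>) = order z [:- cis \<omega>, 1:] + order z [:- cis (- \<omega>), 1:]"
    by (simp only:) (rule order_mult, simp)
  then show ?thesis using ne unfolding order_linear by auto
next
  case False
  then consider "\<omega> = 0" | "\<omega> = pi" using assms by fastforce
  then show ?thesis
  proof cases
    case 1
    then have "Delta \<omega> = smult (-1) [:- 1, 1:]" by (simp add: Delta_def)
    then have "order z (Delta \<omega>) = order z [:- 1, 1:]" by (simp only:) (rule order_smult, simp)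
    then show ?thesis using 1 order_linear[of z 1] by simp
  next
    case 2
    then have "Delta \<omega> = [:- (-1), 1:]" by (simp add: Delta_def)
    then show ?thesis using 2 order_linear[of z "-1"] by (simp add: complex_eq_iff)
  qed
qed

lemma order_prod:
  assumes "finite A" "\<And>i. i \<in> A \<Longrightarrow> f i \<noteq> 0"
  shows "order z (\<Prod>i\<in>A. f i) = (\<Sum>i\<in>A. order z (f i))"
  using assms by (induction A rule: finite_induct) (auto simp: order_mult)

lemma order_power: "p \<noteq> 0 \<Longrightarrow> order z (p ^ n) = n * order z p"
  by (induction n) (auto simp: order_mult)

context
  fixes L :: "(real^'n::{finite,wellorder}) set"
  assumes L: "subspace L" "L \<noteq> UNIV"
begin

lemma Delta_total_nonzero: "Delta_total L \<noteq> 0"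
  by (simp add: Delta_total_def prod_zero_iff finite_freqs[OF L] Delta_nonzero)

lemma order_Delta_total_sum:
  "order z (Delta_total L) = (\<Sum>\<omega>\<in>freqs L. if z = cis \<omega> \<or> z = cis (- \<omega>) then rho \<omega> L else 0)"
proof -
  have "order z (Delta_total L) = (\<Sum>\<omega>\<in>freqs L. rho \<omega> L * order z (Delta \<omega>))"
    unfolding Delta_total_def
    by (simp add: order_prod finite_freqs[OF L] Delta_nonzero order_power)
  also have "\<dots> = (\<Sum>\<omega>\<in>freqs L. if z = cis \<omega> \<or> z = cis (- \<omega>) then rho \<omega> L else 0)"
    by (intro sum.cong) (auto simp: order_Delta freqs_def)
  finally show ?thesis .
qed

text \<open>The real part of \<open>z\<close> determines the frequency, as cos is injective on
  [0, pi]; hence at most one factor contributes. If \<open>\<gamma>\<close> is not in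
  \<open>freqs L\<close>, both sides are 0.\<close>

lemma order_Delta_total:
  assumes "\<gamma> \<in> {0..pi}" and z: "z = cis \<gamma> \<or> z = cis (- \<gamma>)"
  shows "order z (Delta_total L) = rho \<gamma> L"
proof -
  have "(z = cis \<omega> \<or> z = cis (- \<omega>)) \<longleftrightarrow> \<omega> = \<gamma>" if "\<omega> \<in> freqs L" for \<omega>
  proof
    assume "z = cis \<omega> \<or> z = cis (- \<omega>)"
    then have "Re z = cos \<omega>" by auto
    moreover have "Re z = cos \<gamma>" using z by auto
    ultimately show "\<omega> = \<gamma>"
      using assms(1) that cos_inj_pi[of \<omega> \<gamma>] by (simp add: freqs_def)
  qed (use z in simp)
  then have "order z (Delta_total L) = (\<Sum>\<omega>\<in>freqs L. if \<omega> = \<gamma> then rho \<omega> L else 0)"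
    unfolding order_Delta_total_sum by (intro sum.cong) auto
  also have "\<dots> = rho \<gamma> L"
    using assms(1) finite_freqs[OF L] by (auto simp: freqs_def)
  finally show ?thesis .
qed

lemma order_Delta_total_le:
  assumes "v \<in> orthogonal_comp L" "v \<noteq> 0"
  shows "order z (Delta_total L) \<le> order z (tpoly v)"
proof (cases "\<exists>\<omega>\<in>freqs L. z = cis \<omega> \<or> z = cis (- \<omega>)")
  case True
  then obtain \<omega> where \<omega>: "\<omega> \<in> {0..pi}" "z = cis \<omega> \<or> z = cis (- \<omega>)" by (auto simp: freqs_def)
  show ?thesis
    using order_Delta_total[OF \<omega>] rho_le_order_tpoly[OF assms, of \<omega>] \<omega>(2)
      order_tpoly_minus[OF assms(2), of \<omega>] by auto
next
  case False
  then have "order z (Delta_total L) = 0"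
    unfolding order_Delta_total_sum by (intro sum.neutral) auto
  then show ?thesis by simp
qed

end

text \<open>Over the complex numbers \<open>p\<close> splits; the induction removes a linear factor
  common to \<open>p\<close> and \<open>q\<close>, which preserves the comparison of orders.\<close>

lemma dvd_of_order_le:
  fixes p q :: "complex poly"
  assumes "p \<noteq> 0" "q \<noteq> 0" "\<And>z. order z p \<le> order z q"
  shows "p dvd q"
  using assms
proof (induction "degree p" arbitrary: p q)
  case 0
  then show ?case by (metis is_unit_iff_degree unit_imp_dvd)
next
  case (Suc n)
  have "\<not> constant (poly p)" using Suc.hyps(2) by (simp add: constant_degree)
  then obtain a where a: "poly p a = 0" using fundamental_theorem_of_algebra by blast
  then obtain p' where p': "p = [:- a, 1:] * p'" by (metis dvdE poly_eq_0_iff_dvd)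
  have "order a p \<noteq> 0" using a Suc.prems(1) by (simp add: order_root)
  then have "poly q a = 0" using Suc.prems(3)[of a] by (auto simp: order_root)
  then obtain q' where q': "q = [:- a, 1:] * q'" by (metis dvdE poly_eq_0_iff_dvd)
  have nz: "p' \<noteq> 0" "q' \<noteq> 0" using Suc.prems p' q' by auto
  have "degree p = Suc (degree p')" using nz by (subst p', subst degree_mult_eq) auto
  then have "n = degree p'" using Suc.hyps(2) by simp
  moreover have "order z p' \<le> order z q'" for z
    using Suc.prems(3)[of z] Suc.prems(1,2) unfolding p' q'
    by (simp add: order_mult del: mult_pCons_left)
  ultimately have "p' dvd q'" using Suc.hyps(1) nz by blast
  then show ?case unfolding p' q' by (rule mult_dvd_mono[OF dvd_refl])
qed

text \<open>The polynomial \<open>W\<^sub>v\<close> of the overview; the division is exact for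
  \<open>v\<close> orthogonal to \<open>L\<close>.\<close>

definition cofactor :: "(real^'n::{finite,wellorder}) set \<Rightarrow> real^'n::_ \<Rightarrow> complex poly" where
  "cofactor L v = tpoly v div Delta_total L"

context
  fixes L :: "(real^'n::{finite,wellorder}) set"
  assumes L: "subspace L" "L \<noteq> UNIV"
begin

lemma tpoly_eq_cofactor:
  assumes "v \<in> orthogonal_comp L"
  shows "tpoly v = Delta_total L * cofactor L v"
proof (cases "v = 0")
  case True
  then show ?thesis by (simp add: cofactor_def tpoly_eq_0_iff[THEN iffD2])
next
  case False
  then have "Delta_total L dvd tpoly v"
    by (intro dvd_of_order_le order_Delta_total_le Delta_total_nonzero L assms)
       (auto simp: tpoly_eq_0_iff)
  then show ?thesis by (simp add: cofactor_def)
qed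

text \<open>Orders add in the factorization of \<open>tpoly v\<close>, and
  \<open>Delta_total L\<close> accounts for exactly \<open>rho \<gamma> L\<close> of them.\<close>

lemma poly_cofactor_eq_0_iff:
  assumes "v \<in> orthogonal_comp L" "v \<noteq> 0" "\<gamma> \<in> {0..pi}" "z = cis \<gamma> \<or> z = cis (- \<gamma>)"
  shows "poly (cofactor L v) z = 0 \<longleftrightarrow> order (cis \<gamma>) (tpoly v) \<noteq> rho \<gamma> L"
proof -
  have nz: "tpoly v \<noteq> 0" using assms(2) by (simp add: tpoly_eq_0_iff)
  have "order z (tpoly v) = order z (Delta_total L) + order z (cofactor L v)"
    using nz unfolding tpoly_eq_cofactor[OF assms(1)] by (rule order_mult)
  moreover have "order z (tpoly v) = order (cis \<gamma>) (tpoly v)"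
    using assms(4) order_tpoly_minus[OF assms(2)] by auto
  moreover have "cofactor L v \<noteq> 0" using nz tpoly_eq_cofactor[OF assms(1)] by auto
  ultimately show ?thesis
    using order_Delta_total[OF L assms(3,4)] by (auto simp: order_root)
qed

lemma poly_cofactor_eq_0:
  assumes "v \<in> orthogonal_comp L" "\<gamma> \<in> {0..pi}" "z = cis \<gamma> \<or> z = cis (- \<gamma>)"
    and orth: "\<And>c. c \<in> columns (E_mat (rho \<gamma> L) \<gamma>) \<Longrightarrow> v \<bullet> c = 0"
  shows "poly (cofactor L v) z = 0"
proof (cases "v = 0")
  case True
  then show ?thesis by (simp add: cofactor_def tpoly_eq_0_iff[THEN iffD2])
next
  case False
  \<comment> \<open>Membership in the complement of \<open>L\<close> handles the indices below
    \<open>rho \<gamma> L\<close>, and \<open>orth\<close> supplies the index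
    \<open>rho \<gamma> L\<close> itself.\<close>
  have "Suc (rho \<gamma> L) \<le> order (cis \<gamma>) (tpoly v)"
    using rho_le_order_tpoly[OF assms(1) False, of \<gamma>] orth
    unfolding le_order_tpoly_iff[OF False] by (metis less_antisym)
  then show ?thesis using poly_cofactor_eq_0_iff[OF assms(1) False assms(2,3)] by simp
qed

end

lemma Delta_total_cnj: "poly (Delta_total L) (cnj z) = cnj (poly (Delta_total L) z)"
  by (auto simp: Delta_total_def poly_prod Delta_def intro!: prod.cong)

section \<open>Spectral densities and weak limits\<close>

lemma filtered_cis: "filtered L f \<nu> = (cmod (poly (Delta_total L) (cis \<nu>)))\<^sup>2 * f \<nu>"
  by (simp add: filtered_def cis_conv_exp)

lemma continuous_cmod_poly_cis: "continuous_on A (\<lambda>x. (cmod (poly p (cis x)))\<^sup>2)"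
  by (intro continuous_intros continuous_on_cis)

lemma borel_measurable_cmod_poly_cis [measurable]:
  "(\<lambda>x. (cmod (poly p (cis x)))\<^sup>2) \<in> borel_measurable borel"
  by (intro borel_measurable_continuous_onI continuous_cmod_poly_cis)

lemma cmod_poly_cis_bound:
  obtains B where "\<And>x. (cmod (poly p (cis x)))\<^sup>2 \<le> B"
proof
  fix x
  have "cmod (poly p (cis x)) \<le> (\<Sum>i\<le>degree p. cmod (coeff p i))"
    unfolding poly_altdef by (rule sum_norm_le) (simp add: norm_mult norm_power)
  then show "(cmod (poly p (cis x)))\<^sup>2 \<le> (\<Sum>i\<le>degree p. cmod (coeff p i))\<^sup>2"
    by (intro power_mono) auto
qed

text \<open>On the full interval \<open>cis\<close> takes the same value at both endpoints, so
  injectivity is used separately on the two halves.\<close>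

lemma finite_zeros_poly_cis:
  assumes "p \<noteq> 0"
  shows "finite {x\<in>{-pi..pi}. poly p (cis x) = 0}"
proof -
  have fin: "finite (cis ` {x\<in>A. poly p (cis x) = 0})" for A
    by (rule finite_subset[OF _ poly_roots_finite[OF assms]]) auto
  have "inj_on cis {-pi..0}"
  proof (rule inj_onI)
    fix x y assume "x \<in> {-pi..0}" "y \<in> {-pi..0}" "cis x = cis y"
    then show "x = y" using inj_onD[OF cis_inj_on, of "- x" "- y"] by (auto simp: complex_eq_iff)
  qed
  then have "inj_on cis {x\<in>{-pi..0}. poly p (cis x) = 0}"
    by (rule inj_on_subset) auto
  then have "finite {x\<in>{-pi..0}. poly p (cis x) = 0}"
    by (rule finite_imageD[OF fin])
  moreover have "finite {x\<in>{0..pi}. poly p (cis x) = 0}"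
    by (rule finite_imageD[OF fin], rule inj_on_subset[OF cis_inj_on]) auto
  ultimately have "finite ({x\<in>{-pi..0}. poly p (cis x) = 0} \<union> {x\<in>{0..pi}. poly p (cis x) = 0})"
    by simp
  then show ?thesis by (rule finite_subset[rotated]) auto
qed

lemma spectral_densitiesD:
  assumes "f \<in> spectral_densities"
  shows "integrable lborel (\<lambda>x. indicator {-pi..pi} x * f x)"
    and "(\<integral>x. indicator {-pi..pi} x * f x \<partial>lborel) = 1"
    and "0 \<le> indicator {-pi..pi} x * f x"
    and "indicator {-pi..pi} (- x) * f (- x) = indicator {-pi..pi} x * f x"
  using assms
  by (auto simp: spectral_densities_def set_integrable_def set_lebesgue_integral_def
      split: split_indicator)

lemma integrable_mult_spectral:
  fixes h :: "real \<Rightarrow> 'a::{real_normed_algebra, banach, second_countable_topology}"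
  assumes "f \<in> spectral_densities" "h \<in> borel_measurable borel" "\<And>x. norm (h x) \<le> B"
  shows "integrable lborel (\<lambda>x. (indicator {-pi..pi} x * f x) *\<^sub>R h x)"
proof (rule Bochner_Integration.integrable_bound)
  show "integrable lborel (\<lambda>x. B * (indicator {-pi..pi} x * f x))"
    using spectral_densitiesD(1)[OF assms(1)] by simp
  note [measurable] = assms(2) borel_measurable_integrable[OF spectral_densitiesD(1)[OF assms(1)]]
  show "(\<lambda>x. (indicator {-pi..pi} x * f x) *\<^sub>R h x) \<in> borel_measurable lborel" by measurable
  show "AE x in lborel. norm ((indicator {-pi..pi} x * f x) *\<^sub>R h x) \<le> norm (B * (indicator {-pi..pi} x * f x))"
  proof (rule AE_I2)
    fix x
    have "norm (h x) \<le> \<bar>B\<bar>" using assms(3)[of x] by linarith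
    then show "norm ((indicator {-pi..pi} x * f x) *\<^sub>R h x) \<le> norm (B * (indicator {-pi..pi} x * f x))"
      using mult_right_mono[of "norm (h x)" "\<bar>B\<bar>" "\<bar>indicator {-pi..pi} x * f x\<bar>"]
      by (simp add: abs_mult mult_ac)
  qed
qed

lemma integrable_cmod_poly_spectral:
  assumes "f \<in> spectral_densities"
  shows "integrable lborel (\<lambda>x. (indicator {-pi..pi} x * f x) * (cmod (poly p (cis x)))\<^sup>2)"
proof -
  obtain B where "\<And>x. (cmod (poly p (cis x)))\<^sup>2 \<le> B" using cmod_poly_cis_bound[of p] by blast
  then show ?thesis
    using integrable_mult_spectral[OF assms, of "\<lambda>x. (cmod (poly p (cis x)))\<^sup>2" B] by simp
qed

text \<open>A vanishing integral would make \<open>f\<close> zero almost everywhere off the finitely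
  many zeros of \<open>p\<close>, against its total mass 1. It yields both the positive
  normalization of the filtered measures and the nonsingularity of \<open>Sigma_mat\<close>.\<close>

lemma integral_cmod_poly_spectral_pos:
  assumes f: "f \<in> spectral_densities" and "p \<noteq> 0"
  shows "0 < (\<integral>x. (indicator {-pi..pi} x * f x) * (cmod (poly p (cis x)))\<^sup>2 \<partial>lborel)" (is "0 < ?I")
proof (rule ccontr)
  note D = spectral_densitiesD[OF f]
  assume "\<not> 0 < ?I"
  moreover have "0 \<le> ?I" by (intro integral_nonneg_AE AE_I2 mult_nonneg_nonneg D) auto
  ultimately have "?I = 0" by simp
  moreover have "AE x in lborel. 0 \<le> (indicator {-pi..pi} x * f x) * (cmod (poly p (cis x)))\<^sup>2"
    by (intro AE_I2 mult_nonneg_nonneg D) auto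
  ultimately have ae: "AE x in lborel. (indicator {-pi..pi} x * f x) * (cmod (poly p (cis x)))\<^sup>2 = 0"
    using integral_nonneg_eq_0_iff_AE[OF integrable_cmod_poly_spectral[OF f, of p]] by blast
  have "{x\<in>{-pi..pi}. poly p (cis x) = 0} \<in> null_sets lborel"
    using finite_imp_null_set_lborel[OF finite_zeros_poly_cis[OF assms(2)]] .
  from AE_not_in[OF this] ae have "AE x in lborel. indicator {-pi..pi} x * f x = 0"
    by eventually_elim (auto split: split_indicator)
  then have "(\<integral>x. indicator {-pi..pi} x * f x \<partial>lborel) = 0"
    by (rule integral_eq_zero_AE)
  then show False using D(2) by simp
qed

lemma Sigma_mat_nth:
  assumes "f \<in> spectral_densities"
  shows "Sigma_mat f $ j $ l =
    (\<integral>x. (indicator {-pi..pi} x * f x) * cos ((time j - time l) * x) \<partial>lborel)"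
proof -
  define h where "h x = cis (- ((time j - time l) * x))" for x
  have eq: "indicator {-pi..pi} x *\<^sub>R (exp (- (\<i> * complex_of_real ((time j - time l) * x))) * complex_of_real (f x))
     = (indicator {-pi..pi} x * f x) *\<^sub>R h x" for x
    by (simp add: h_def cis_conv_exp scaleR_conv_of_real mult_ac)
  have "integrable lborel (\<lambda>x. (indicator {-pi..pi} x * f x) *\<^sub>R h x)"
    by (rule integrable_mult_spectral[OF assms, where B = 1])
       (auto simp: h_def intro!: borel_measurable_continuous_onI continuous_on_cis continuous_intros)
  from integral_Re[OF this] show ?thesis
    unfolding Sigma_mat_def set_lebesgue_integral_def vec_lambda_beta eq by (simp add: h_def)
qed

lemma quadform_Sigma_mat:
  assumes f: "f \<in> spectral_densities"
  shows "v \<bullet> (Sigma_mat f *v v) =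
    (\<integral>x. (indicator {-pi..pi} x * f x) * (cmod (poly (tpoly v) (cis x)))\<^sup>2 \<partial>lborel)"
proof -
  let ?w = "\<lambda>x. indicator {-pi..pi} x * f x"
  have int: "integrable lborel (\<lambda>x. ?w x * cos ((time j - time l) * x))" for j l :: 'a
    using integrable_mult_spectral[OF f, of "\<lambda>x. cos ((time j - time l) * x)" 1] by simp
  have "v \<bullet> (Sigma_mat f *v v) = (\<Sum>j\<in>UNIV. \<Sum>l\<in>UNIV. v$j * v$l * (\<integral>x. ?w x * cos ((time j - time l) * x) \<partial>lborel))"
    by (simp add: inner_vec_def matrix_vector_mult_def Sigma_mat_nth[OF f] sum_distrib_left mult_ac)
  also have "\<dots> = (\<integral>x. (\<Sum>j\<in>UNIV. \<Sum>l\<in>UNIV. v$j * v$l * (?w x * cos ((time j - time l) * x))) \<partial>lborel)"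
    using int by simp
  also have "(\<lambda>x. (\<Sum>j\<in>UNIV. \<Sum>l\<in>UNIV. v$j * v$l * (?w x * cos ((time j - time l) * x)))) =
     (\<lambda>x. ?w x * (cmod (poly (tpoly v) (cis x)))\<^sup>2)"
  proof
    fix x
    \<comment> \<open>The squared modulus splits into cosine and sine sums, which recombine through
      the addition formula for the cosine of a difference.\<close>
    have "(cmod (poly (tpoly v) (cis x)))\<^sup>2 =
        (\<Sum>j\<in>UNIV. v$j * cos (time j * x))\<^sup>2 + (\<Sum>j\<in>UNIV. v$j * sin (time j * x))\<^sup>2"
      by (simp add: poly_tpoly_cis cmod_power2)
    also have "\<dots> = (\<Sum>j\<in>UNIV. \<Sum>l\<in>UNIV. v$j * v$l * cos ((time j - time l) * x))"
      by (simp add: power2_eq_square sum_product sum.distrib[symmetric] left_diff_distrib cos_diff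
          algebra_simps)
    finally show "(\<Sum>j\<in>UNIV. \<Sum>l\<in>UNIV. v$j * v$l * (?w x * cos ((time j - time l) * x))) =
        ?w x * (cmod (poly (tpoly v) (cis x)))\<^sup>2"
      by (simp add: sum_distrib_left mult_ac)
  qed
  finally show ?thesis .
qed

lemma transpose_Sigma_mat:
  assumes "f \<in> spectral_densities"
  shows "transpose (Sigma_mat f) = Sigma_mat f"
proof -
  have "cos ((time i - time j) * x) = cos ((time j - time i) * x)" for i j :: 'a and x
    by (metis cos_minus minus_diff_eq minus_mult_left)
  then show ?thesis by (simp add: vec_eq_iff transpose_def Sigma_mat_nth[OF assms])
qed

lemma Sigma_mat_pos_def:
  assumes "f \<in> spectral_densities" "v \<noteq> 0"
  shows "0 < v \<bullet> (Sigma_mat f *v v)"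
  using integral_cmod_poly_spectral_pos[OF assms(1), of "tpoly v"] assms(2)
  by (simp add: quadform_Sigma_mat[OF assms(1)] tpoly_eq_0_iff)

section \<open>The filtered measures for a fixed spectral density\<close>

context
  fixes L :: "(real^'n::{finite,wellorder}) set" and f :: "real \<Rightarrow> real" and c :: real
  assumes L: "subspace L" "L \<noteq> UNIV" and f: "f \<in> spectral_densities"
  defines "c \<equiv> (LINT \<nu>:{-pi..pi}|lborel. filtered L f \<nu>)"
begin

lemma integral_filtered_pos: "0 < c"
proof -
  have "c = (\<integral>x. (indicator {-pi..pi} x * f x) * (cmod (poly (Delta_total L) (cis x)))\<^sup>2 \<partial>lborel)"
    by (simp add: c_def set_lebesgue_integral_def filtered_cis mult_ac)
  then show ?thesis using integral_cmod_poly_spectral_pos[OF f Delta_total_nonzero[OF L]] by simp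
qed

private definition "g x = (indicator {-pi..pi} x * f x) * (cmod (poly (Delta_total L) (cis x)))\<^sup>2 / c"

private lemma filtered_measure_eq: "filtered_measure L f = density lborel (\<lambda>x. ennreal (g x))"
  unfolding filtered_measure_def c_def[symmetric] by (simp add: g_def filtered_cis mult_ac)

private lemma g_facts: "integrable lborel g" "(\<integral>x. g x \<partial>lborel) = 1" "0 \<le> g x" "g (- x) = g x"
proof -
  have c: "c = (\<integral>x. (indicator {-pi..pi} x * f x) * (cmod (poly (Delta_total L) (cis x)))\<^sup>2 \<partial>lborel)"
    by (simp add: c_def set_lebesgue_integral_def filtered_cis mult_ac)
  show "integrable lborel g"
    using integrable_cmod_poly_spectral[OF f, of "Delta_total L"] by (simp add: g_def[abs_def])
  show "(\<integral>x. g x \<partial>lborel) = 1"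
    using integral_filtered_pos by (simp add: g_def c[symmetric])
  show "0 \<le> g x" unfolding g_def using spectral_densitiesD(3)[OF f, of x] integral_filtered_pos by simp
  have "poly (Delta_total L) (cis (- x)) = cnj (poly (Delta_total L) (cis x))"
    unfolding Delta_total_cnj[symmetric] by (simp add: cis_cnj)
  then show "g (- x) = g x" unfolding g_def spectral_densitiesD(4)[OF f] by simp
qed

private lemma measurable_g [measurable]: "g \<in> borel_measurable borel"
  using borel_measurable_integrable[OF g_facts(1)] by simp

lemma real_distribution_filtered_measure: "real_distribution (filtered_measure L f)"
proof -
  have "(\<integral>\<^sup>+x. ennreal (g x) \<partial>lborel) = 1"
    using nn_integral_eq_integral[OF g_facts(1)] g_facts by simp
  then have "prob_space (filtered_measure L f)"
    unfolding filtered_measure_eq by (intro prob_spaceI) (simp add: emeasure_density)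
  then show ?thesis
    by (simp add: real_distribution_def real_distribution_axioms_def filtered_measure_def)
qed

text \<open>The density is even, since \<open>f\<close> is even and \<open>Delta_total L\<close> has
  real coefficients. Symmetry is phrased through characteristic functions because these converge
  pointwise under weak limits.\<close>

lemma char_filtered_measure_minus: "char (filtered_measure L f) (- t) = char (filtered_measure L f) t"
proof -
  have ch: "char (filtered_measure L f) s = (\<integral>x. g x *\<^sub>R iexp (s * x) \<partial>lborel)" for s
    unfolding char_def filtered_measure_eq by (rule integral_density) (auto simp: g_facts)
  show ?thesis
    unfolding ch by (subst (2) lborel_integral_real_affine[of "-1" _ 0]) (simp_all add: g_facts)
qed

text \<open>The factor of \<open>tpoly v\<close> coming from \<open>Delta_total L\<close> is
  absorbed into the filtered density.\<close>

lemma quadform_Sigma_mat_filtered: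
  assumes v: "v \<in> orthogonal_comp L"
  shows "v \<bullet> (Sigma_mat f *v v) / c = (\<integral>x. (cmod (poly (cofactor L v) (cis x)))\<^sup>2 \<partial>filtered_measure L f)"
proof -
  have "(\<integral>x. (cmod (poly (cofactor L v) (cis x)))\<^sup>2 \<partial>filtered_measure L f)
     = (\<integral>x. g x *\<^sub>R (cmod (poly (cofactor L v) (cis x)))\<^sup>2 \<partial>lborel)"
    unfolding filtered_measure_eq by (rule integral_density) (auto simp: g_facts)
  also have "\<dots> = (\<integral>x. (indicator {-pi..pi} x * f x) * (cmod (poly (tpoly v) (cis x)))\<^sup>2 / c \<partial>lborel)"
    by (simp add: g_def tpoly_eq_cofactor[OF L v] norm_mult power_mult_distrib mult_ac)
  finally show ?thesis by (simp add: quadform_Sigma_mat[OF f])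
qed

end

lemma distr_uminus_weak_limit:
  assumes M: "\<And>m. real_distribution (\<mu> m)" "real_distribution M" "weak_conv_m \<mu> M"
    and sym: "\<And>m t. char (\<mu> m) (- t) = char (\<mu> m) t"
  shows "distr M borel uminus = M"
proof (rule Levy_uniqueness[OF _ M(2)])
  interpret M: real_distribution M by (rule M)
  show "real_distribution (distr M borel uminus)" by (rule M.real_distribution_distr) simp
  show "char (distr M borel uminus) = char M"
  proof
    fix t
    have "char (distr M borel uminus) t = char M (- t)"
      unfolding char_def by (subst integral_distr) simp_all
    also have "\<dots> = char M t"
      using levy_continuity1[OF M, of "- t"] levy_continuity1[OF M, of t] unfolding sym
      by (rule LIMSEQ_unique)
    finally show "char (distr M borel uminus) t = char M t" .
  qed
qed

text \<open>The complement of the support is a union of open null sets, of which countably many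
  suffice by Lindelof.\<close>

lemma AE_measure_supp:
  fixes M :: "'a::second_countable_topology measure"
  assumes "sets M = sets borel"
  shows "AE x in M. x \<in> measure_supp M"
proof -
  let ?N = "{U. open U \<and> emeasure M U = 0}"
  obtain \<U> where \<U>: "\<U> \<subseteq> ?N" "countable \<U>" "\<Union>\<U> = \<Union>?N"
    by (rule Lindelof[of ?N]) auto
  have "(\<Union>U\<in>\<U>. U) \<in> null_sets M"
    by (rule null_sets_UN'[OF \<U>(2)]) (use \<U>(1) assms in \<open>auto simp: null_sets_def\<close>)
  then have "\<Union>\<U> \<in> null_sets M" by simp
  then have "AE x in M. x \<notin> \<Union>\<U>" by (rule AE_not_in)
  then show ?thesis
    unfolding \<U>(3) by eventually_elim (auto simp: measure_supp_def zero_less_iff_neq_zero)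
qed

text \<open>By symmetry \<open>M\<close> is carried by its support and by the reflected support, and
  one of \<open>x\<close> and \<open>- x\<close> lies in [0, pi].\<close>

lemma AE_symmetric_supp:
  assumes "real_distribution M" "emeasure M (- {-pi..pi}) = 0" "distr M borel uminus = M"
    and \<Gamma>: "measure_supp M \<inter> {0..pi} = \<Gamma>"
  shows "AE x in M. x \<in> \<Gamma> \<or> - x \<in> \<Gamma>"
proof -
  interpret M: real_distribution M by fact
  have supp: "AE x in M. x \<in> measure_supp M" by (rule AE_measure_supp) simp
  have "AE x in distr M borel uminus. x \<in> measure_supp M" unfolding assms(3) by (rule supp)
  then have supp': "AE x in M. - x \<in> measure_supp M"
    by (rule AE_distrD[rotated]) simp
  have "- {-pi..pi} \<in> null_sets M" using assms(2) by (auto simp: null_sets_def)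
  from AE_not_in[OF this] supp supp' show ?thesis
    by eventually_elim (use \<Gamma> in auto)
qed

text \<open>Collects what the probabilistic part needs from the spectral part. The squared modulus
  of the cofactor is bounded, continuous and independent of \<open>m\<close>, so weak convergence of
  the filtered measures applies to it.\<close>

lemma spectral_limit:
  fixes L :: "(real^'n::{finite,wellorder}) set"
  assumes L: "subspace L" "L \<noteq> UNIV" and F: "F \<subseteq> spectral_densities" and \<Gamma>: "\<Gamma> \<in> sing_sets F L"
  obtains f c q where "\<And>m :: nat. f m \<in> F" "\<And>m. 0 < (c m :: real)"
    "\<And>v. v \<in> orthogonal_comp L \<Longrightarrow> (\<lambda>m. v \<bullet> (Sigma_mat (f m) *v v) / c m) \<longlonglongrightarrow> q v"
    "\<And>v. v \<in> orthogonal_comp L \<Longrightarrow>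
       v \<in> orthogonal_comp (\<Union>\<gamma>\<in>\<Gamma>. columns (E_mat (rho \<gamma> L) \<gamma>)) \<Longrightarrow> q v = 0"
    "\<exists>v\<in>orthogonal_comp L. q v \<noteq> 0"
proof -
  obtain f M where fF: "\<And>m. f m \<in> F" and M: "real_distribution M" "emeasure M (- {-pi..pi}) = 0"
      and weak: "weak_conv_m (\<lambda>m. filtered_measure L (f m)) M"
      and supp: "measure_supp M \<inter> {0..pi} = \<Gamma>" and \<Gamma>pi: "\<Gamma> \<subseteq> {0..pi}"
    using \<Gamma> by (auto simp: sing_sets_def)
  interpret M: real_distribution M by (rule M)
  have f: "f m \<in> spectral_densities" for m using fF F by blast
  define c where "c m = (LINT \<nu>:{-pi..pi}|lborel. filtered L (f m) \<nu>)" for m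
  define q where "q v = (\<integral>x. (cmod (poly (cofactor L v) (cis x)))\<^sup>2 \<partial>M)" for v
  note rd = real_distribution_filtered_measure[OF L f]
  have "distr M borel uminus = M"
    using rd M(1) weak by (rule distr_uminus_weak_limit) (rule char_filtered_measure_minus[OF L f])
  then have ae: "AE x in M. x \<in> \<Gamma> \<or> - x \<in> \<Gamma>"
    using AE_symmetric_supp M supp by blast
  have lim: "(\<lambda>m. v \<bullet> (Sigma_mat (f m) *v v) / c m) \<longlonglongrightarrow> q v" if v: "v \<in> orthogonal_comp L" for v
  proof -
    obtain B where B: "\<And>x. (cmod (poly (cofactor L v) (cis x)))\<^sup>2 \<le> B"
      using cmod_poly_cis_bound[of "cofactor L v"] by blast
    have "(\<lambda>m. \<integral>x. (cmod (poly (cofactor L v) (cis x)))\<^sup>2 \<partial>filtered_measure L (f m)) \<longlonglongrightarrow> q v"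
      unfolding q_def using rd M(1) weak
    proof (rule weak_conv_imp_integral_bdd_continuous_conv)
      show "isCont (\<lambda>x. (cmod (poly (cofactor L v) (cis x)))\<^sup>2) x" for x
        using continuous_cmod_poly_cis[of UNIV] by (simp add: continuous_on_eq_continuous_at)
      show "norm ((cmod (poly (cofactor L v) (cis x)))\<^sup>2) \<le> B" for x using B[of x] by simp
    qed
    then show ?thesis by (simp add: quadform_Sigma_mat_filtered[OF L f v] c_def)
  qed
  have q0: "q v = 0" if v: "v \<in> orthogonal_comp L"
    and vE: "v \<in> orthogonal_comp (\<Union>\<gamma>\<in>\<Gamma>. columns (E_mat (rho \<gamma> L) \<gamma>))" for v
  proof -
    have orth: "v \<bullet> x = 0" if "\<gamma> \<in> \<Gamma>" "x \<in> columns (E_mat (rho \<gamma> L) \<gamma>)" for \<gamma> x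
      using vE that unfolding orthogonal_comp_def orthogonal_def by (subst inner_commute) blast
    have zero: "poly (cofactor L v) (cis x) = 0" if "x \<in> \<Gamma> \<or> - x \<in> \<Gamma>" for x
      using that
    proof
      assume "x \<in> \<Gamma>"
      then show ?thesis
        using poly_cofactor_eq_0[OF L v, of x "cis x"] orth[of x] \<Gamma>pi by blast
    next
      assume "- x \<in> \<Gamma>"
      then show ?thesis
        using poly_cofactor_eq_0[OF L v, of "- x" "cis x"] orth[of "- x"] \<Gamma>pi by auto
    qed
    from ae have "AE x in M. (cmod (poly (cofactor L v) (cis x)))\<^sup>2 = 0"
      by eventually_elim (use zero in auto)
    then show ?thesis unfolding q_def by (rule integral_eq_zero_AE)
  qed
  have "\<Gamma> \<noteq> {}"
  proof
    assume "\<Gamma> = {}"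
    then have "AE x in M. False" using ae by simp
    then show False using M.AE_False by simp
  qed
  then obtain \<gamma> where \<gamma>: "\<gamma> \<in> \<Gamma>" by blast
  then have \<gamma>': "\<gamma> \<in> {0..pi}" "\<gamma> \<in> measure_supp M" using supp by auto
  \<comment> \<open>For a \<open>v\<close> of minimal order the cofactor is nonzero at the support
    point \<open>\<gamma>\<close>, hence on a neighbourhood charged by \<open>M\<close>.\<close>
  obtain v where v: "v \<in> orthogonal_comp L" "v \<noteq> 0" "order (cis \<gamma>) (tpoly v) = rho \<gamma> L"
    using rho_eq_order_tpoly[OF L, of \<gamma>] .
  have nz: "poly (cofactor L v) (cis \<gamma>) \<noteq> 0"
    using poly_cofactor_eq_0_iff[OF L v(1,2) \<gamma>'(1), of "cis \<gamma>"] v(3) by simp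
  have "q v \<noteq> 0"
  proof
    assume "q v = 0"
    obtain B where B: "\<And>x. (cmod (poly (cofactor L v) (cis x)))\<^sup>2 \<le> B"
      using cmod_poly_cis_bound[of "cofactor L v"] by blast
    have "integrable M (\<lambda>x. (cmod (poly (cofactor L v) (cis x)))\<^sup>2)"
      by (rule M.integrable_const_bound[where B = B]) (auto simp: B)
    from integral_nonneg_eq_0_iff_AE[OF this] \<open>q v = 0\<close>
    have "AE x in M. (cmod (poly (cofactor L v) (cis x)))\<^sup>2 = 0" by (simp add: q_def)
    then have "AE x in M. x \<notin> {x. poly (cofactor L v) (cis x) \<noteq> 0}" by simp
    moreover have op: "open {x. poly (cofactor L v) (cis x) \<noteq> 0}"
      using open_Collect_neq[OF _ continuous_on_const, of "\<lambda>x. poly (cofactor L v) (cis x)" 0]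
      by (simp add: continuous_intros continuous_on_cis)
    ultimately have "emeasure M {x. poly (cofactor L v) (cis x) \<noteq> 0} = 0"
      by (subst (asm) AE_iff_null_sets[symmetric]) (auto simp: null_sets_def)
    then show False using \<gamma>'(2) op nz by (auto simp: measure_supp_def)
  qed
  then have "\<exists>v\<in>orthogonal_comp L. q v \<noteq> 0" using v(1) by blast
  moreover have "0 < c m" for m unfolding c_def by (rule integral_filtered_pos[OF L f])
  ultimately show thesis using that[of f c q, OF fF _ lim q0] by blast
qed

section \<open>The test statistic\<close>

lemma matrix_inv_mult_right:
  fixes A :: "real^'n^'n"
  assumes "det A \<noteq> 0"
  shows "A ** matrix_inv A = mat 1"
proof -
  have "\<exists>B. A ** B = mat 1 \<and> B ** A = mat 1"
    using assms by (simp add: invertible_det_nz[symmetric] invertible_def)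
  then show ?thesis unfolding matrix_inv_def by (rule someI2_ex) simp
qed

text \<open>Cauchy-Schwarz for \<open>A\<close> applied to \<open>g\<close> and
  \<open>matrix_inv A *v g\<close>: a small form of \<open>A\<close> at \<open>g\<close> forces a
  large inverse form, with no control of eigenvalues.\<close>

lemma matrix_inv_quadform_bound:
  fixes A :: "real^'n^'n"
  assumes sym: "transpose A = A" and psd: "\<And>x. 0 \<le> x \<bullet> (A *v x)" and det: "det A \<noteq> 0"
  shows "(g \<bullet> g)\<^sup>2 \<le> (g \<bullet> (A *v g)) * (g \<bullet> (matrix_inv A *v g))"
proof -
  have "A *v (matrix_inv A *v g) = g"
    by (simp add: matrix_vector_mul_assoc matrix_inv_mult_right[OF det])
  then show ?thesis
    using psd_Cauchy_Schwarz[OF sym psd, of g "matrix_inv A *v g"] by (simp add: inner_commute)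
qed

lemma continuous_on_det:
  fixes A :: "'a::topological_space \<Rightarrow> real^'n^'n"
  assumes "\<And>i j. continuous_on S (\<lambda>y. A y $ i $ j)"
  shows "continuous_on S (\<lambda>y. det (A y))"
  unfolding det_def by (intro continuous_intros assms)

text \<open>Cramer's rule writes the statistic as a rational expression in continuous determinants,
  so \<open>matrix_inv\<close> need not be studied as a function.\<close>

lemma borel_measurable_F_type_stat:
  fixes X :: "real^'k^'n" and Omega :: "real^'n \<Rightarrow> real^'q^'q"
  assumes "estimator_conditions X bhat Omega {}"
  shows "F_type_stat R r bhat Omega {} \<in> borel_measurable borel"
proof -
  define g where "g y = R *v bhat y - r" for y
  define d where "d y = det (Omega y)" for y
  define N where "N k y = det (\<chi> i j. if j = k then g y $ i else Omega y $ i $ j)" for k y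
  have cont: "continuous_on UNIV bhat" "continuous_on UNIV Omega"
    using assms by (auto simp: estimator_conditions_def)
  have g: "continuous_on UNIV (\<lambda>y. g y $ i)" for i
    unfolding g_def by (simp add: matrix_vector_mult_def) (intro continuous_intros cont)
  have \<Omega>: "continuous_on UNIV (\<lambda>y. Omega y $ i $ j)" for i j
    by (intro continuous_intros cont)
  have N: "continuous_on UNIV (N k)" for k
    unfolding N_def[abs_def] 
  proof (rule continuous_on_det)
    show "continuous_on UNIV (\<lambda>y. (\<chi> i j. if j = k then g y $ i else Omega y $ i $ j) $ i $ j)" for i j
      by (cases "j = k") (simp_all add: g \<Omega>)
  qed
  have [measurable]: "(\<lambda>y. g y $ i) \<in> borel_measurable borel" "d \<in> borel_measurable borel"
      "N k \<in> borel_measurable borel" for i k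
    using g N continuous_on_det[OF \<Omega>] unfolding d_def
    by (auto intro: borel_measurable_continuous_onI)
  have "F_type_stat R r bhat Omega {} = (\<lambda>y. if d y = 0 then 0 else \<Sum>k\<in>UNIV. g y $ k * (N k y / d y))"
  proof
    fix y
    show "F_type_stat R r bhat Omega {} y = (if d y = 0 then 0 else \<Sum>k\<in>UNIV. g y $ k * (N k y / d y))"
    proof (cases "d y = 0")
      case False
      then have "Omega y *v (matrix_inv (Omega y) *v g y) = g y"
        by (simp add: matrix_vector_mul_assoc matrix_inv_mult_right d_def)
      then have "matrix_inv (Omega y) *v g y = (\<chi> k. N k y / d y)"
        using False unfolding d_def N_def by (subst (asm) cramer) auto
      then show ?thesis using False by (simp add: F_type_stat_def d_def g_def inner_vec_def)
    qed (simp add: F_type_stat_def d_def)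
  qed
  also have "\<dots> \<in> borel_measurable borel" by measurable
  finally show ?thesis .
qed

lemma tendsto_matrix_vector_mult:
  fixes A :: "'a \<Rightarrow> real^'n^'m"
  assumes "(A \<longlongrightarrow> a) F" "(x \<longlongrightarrow> b) F"
  shows "((\<lambda>t. A t *v x t) \<longlongrightarrow> a *v b) F"
  by (rule vec_tendstoI) (simp add: matrix_vector_mult_def, intro tendsto_intros assms)

lemma tendsto_transpose:
  fixes A :: "'a \<Rightarrow> real^'n^'m"
  assumes "(A \<longlongrightarrow> a) F"
  shows "((\<lambda>t. transpose (A t)) \<longlongrightarrow> transpose a) F"
  by (intro vec_tendstoI) (simp add: transpose_def, intro tendsto_intros assms)

text \<open>Equivariance forces the two estimators to agree with \<open>\<eta>\<close> and \<open>0\<close> at \<open>X\<eta>\<close>, because \<open>0\<close> is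
  fixed by every rescaling.\<close>

lemma estimator_conditions_range:
  assumes "estimator_conditions X bhat Omega {}"
  shows "bhat (X *v \<eta>) = \<eta>" "Omega (X *v \<eta>) = 0"
proof -
  have eq: "bhat (X *v \<eta>) = \<delta> *\<^sub>R bhat 0 + \<eta>" "Omega (X *v \<eta>) = \<delta>\<^sup>2 *\<^sub>R Omega 0" if "\<delta> \<noteq> 0" for \<delta>
  proof -
    have "bhat (\<delta> *\<^sub>R 0 + X *v \<eta>) = \<delta> *\<^sub>R bhat 0 + \<eta> \<and>
        Omega (\<delta> *\<^sub>R 0 + X *v \<eta>) = \<delta>\<^sup>2 *\<^sub>R Omega 0"
      using assms that by (auto simp only: estimator_conditions_def empty_iff not_False_eq_True)
    then show "bhat (X *v \<eta>) = \<delta> *\<^sub>R bhat 0 + \<eta>" "Omega (X *v \<eta>) = \<delta>\<^sup>2 *\<^sub>R Omega 0"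
      by simp_all
  qed
  \<comment> \<open>Comparing the scalings 1 and 2 gives \<open>bhat 0\<close> = 2
    \<open>bhat 0\<close>, and below \<open>Omega 0\<close> = 4 \<open>Omega 0\<close>.\<close>
  have "bhat 0 = 0" using eq(1)[of 1] eq(1)[of 2] by (simp add: scaleR_2)
  then show "bhat (X *v \<eta>) = \<eta>" using eq(1)[of 1] by simp
  have "1 *\<^sub>R Omega 0 = 4 *\<^sub>R Omega 0" using eq(2)[of 1] eq(2)[of 2] by simp
  then have "Omega 0 = 0" unfolding scaleR_cancel_right by simp
  then show "Omega (X *v \<eta>) = 0" using eq(2)[of 1] by simp
qed

text \<open>The statistic is unbounded along sequences which, up to its invariance group, approach a point
  of the column space outside the null hypothesis: there \<open>Omega\<close> vanishes while \<open>R \<beta> - r\<close> does not.\<close>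

lemma eventually_F_type_stat_ge:
  fixes X :: "real^'k^'n" and Omega :: "real^'n \<Rightarrow> real^'q^'q" and y :: "nat \<Rightarrow> real^'n"
  assumes est: "estimator_conditions X bhat Omega {}"
    and psd: "\<And>y x. 0 \<le> x \<bullet> (Omega y *v x)"
    and \<delta>: "\<And>m. \<delta> m \<noteq> 0" and \<zeta>: "\<And>m. R *v \<zeta> m = (1 - \<delta> m) *\<^sub>R r"
    and lim: "(\<lambda>m. \<delta> m *\<^sub>R y m + X *v \<zeta> m) \<longlonglongrightarrow> X *v \<beta>" and \<beta>: "R *v \<beta> \<noteq> r"
    and det: "\<And>m. det (Omega (y m)) \<noteq> 0"
  shows "\<forall>\<^sub>F m in sequentially. C \<le> F_type_stat R r bhat Omega {} (y m)"
proof -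
  \<comment> \<open>The condition on \<open>\<zeta>\<close> makes \<open>R *v bhat - r\<close> at
    \<open>y' m\<close> equal to \<open>\<delta> m\<close> times its value at
    \<open>y m\<close>.\<close>
  define y' where "y' m = \<delta> m *\<^sub>R y m + X *v \<zeta> m" for m
  define g where "g m = R *v bhat (y' m) - r" for m
  define h where "h m = g m \<bullet> (Omega (y' m) *v g m)" for m
  define T where "T m = F_type_stat R r bhat Omega {} (y m)" for m
  have cont: "isCont bhat z" "isCont Omega z" for z
    using est by (auto simp: estimator_conditions_def continuous_on_eq_continuous_at)
  have equiv: "bhat (y' m) = \<delta> m *\<^sub>R bhat (y m) + \<zeta> m" "Omega (y' m) = (\<delta> m)\<^sup>2 *\<^sub>R Omega (y m)" for m
    using est \<delta>[of m] by (auto simp: estimator_conditions_def y'_def)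
  have "(\<lambda>m. bhat (y' m)) \<longlonglongrightarrow> \<beta>" "(\<lambda>m. Omega (y' m)) \<longlonglongrightarrow> 0"
    using isCont_tendsto_compose[OF cont(1) lim] isCont_tendsto_compose[OF cont(2) lim]
    by (simp_all add: y'_def estimator_conditions_range[OF est])
  note lims = this
  have glim: "g \<longlonglongrightarrow> R *v \<beta> - r"
    unfolding g_def by (intro tendsto_intros tendsto_matrix_vector_mult lims)
  then have "h \<longlonglongrightarrow> (R *v \<beta> - r) \<bullet> (0 *v (R *v \<beta> - r))"
    unfolding h_def by (intro tendsto_intros tendsto_matrix_vector_mult lims)
  then have "h \<longlonglongrightarrow> 0" by simp
  \<comment> \<open>The limit is positive because \<open>R *v \<beta>\<close> differs from
    \<open>r\<close>; the absolute value covers critical values of either sign.\<close>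
  then have "(\<lambda>m. (g m \<bullet> g m)\<^sup>2 - h m * \<bar>C\<bar>) \<longlonglongrightarrow> ((R *v \<beta> - r) \<bullet> (R *v \<beta> - r))\<^sup>2 - 0 * \<bar>C\<bar>"
    by (intro tendsto_intros glim)
  then have ev: "\<forall>\<^sub>F m in sequentially. 0 < (g m \<bullet> g m)\<^sup>2 - h m * \<bar>C\<bar>"
    by (rule order_tendstoD(1)) (use \<beta> in simp)
  have bound: "(g m \<bullet> g m)\<^sup>2 \<le> h m * T m" for m
  proof -
    define a where "a = R *v bhat (y m) - r"
    have g: "g m = \<delta> m *\<^sub>R a"
      by (simp add: g_def a_def equiv matrix_vector_right_distrib matrix_vector_mult_scaleR \<zeta>
          algebra_simps)
    have "(a \<bullet> a)\<^sup>2 \<le> (a \<bullet> (Omega (y m) *v a)) * T m"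
      using matrix_inv_quadform_bound[OF _ psd det, of m a] est det[of m]
      by (simp add: estimator_conditions_def T_def F_type_stat_def a_def)
    \<comment> \<open>Residuals scale by \<open>\<delta> m\<close> and \<open>Omega\<close> by its
      square, so both sides of the bound pick up the fourth power while \<open>T m\<close> is
      unchanged.\<close>
    then have "(\<delta> m)^4 * (a \<bullet> a)\<^sup>2 \<le> (\<delta> m)^4 * ((a \<bullet> (Omega (y m) *v a)) * T m)"
      by (intro mult_left_mono) auto
    moreover have "h m = (\<delta> m)^4 * (a \<bullet> (Omega (y m) *v a))"
      by (simp add: h_def g equiv matrix_vector_mult_scaleR scaleR_matrix_vector_assoc[symmetric]
          power4_eq_xxxx power2_eq_square)
    moreover have "(g m \<bullet> g m)\<^sup>2 = (\<delta> m)^4 * (a \<bullet> a)\<^sup>2"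
      by (simp add: g power4_eq_xxxx power2_eq_square)
    ultimately show ?thesis by (simp add: mult.assoc)
  qed
  from ev show ?thesis
  proof eventually_elim
    case (elim m)
    then have "h m * \<bar>C\<bar> < h m * T m" using bound[of m] by linarith
    moreover have "0 \<le> h m" unfolding h_def by (rule psd)
    ultimately have "\<bar>C\<bar> < T m" by (simp add: mult_less_cancel_left)
    then show ?case by (simp add: T_def)
  qed
qed

section \<open>Geometry of the null hypothesis and limits of Gaussian factors\<close>

lemma null_hyp_lin_subspace: "subspace (null_hyp_lin X R)"
proof -
  have "null_hyp_lin X R = (\<lambda>\<beta>. X *v \<beta>) ` {\<beta>. R *v \<beta> = 0}"
    by (auto simp: null_hyp_lin_def)
  moreover have "subspace {\<beta>. R *v \<beta> = 0}"
    by (auto simp: subspace_def matrix_vector_right_distrib matrix_vector_mult_scaleR)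
  ultimately show ?thesis by (metis linear_subspace_image matrix_vector_mul_linear)
qed

lemma null_hyp_lin_subset_columns: "null_hyp_lin X R \<subseteq> span (columns X)"
  by (auto simp: null_hyp_lin_def matrix_vector_mult_in_columnspace)

lemma null_hyp_lin_neq_UNIV:
  fixes X :: "real^'k^'n"
  assumes "CARD('k) < CARD('n)"
  shows "null_hyp_lin X R \<noteq> UNIV"
proof
  assume "null_hyp_lin X R = UNIV"
  then have "dim (span (columns X)) = CARD('n)"
    using null_hyp_lin_subset_columns[of X R] by (simp add: top.extremum_unique)
  then show False
    using assms rank_bound[of X] by (simp add: column_rank_def)
qed

lemma span_columns_range: "span (columns X) = range (\<lambda>\<eta>. X *v \<eta>)"
  for X :: "real^'k^'n"
proof
  have "columns X \<subseteq> range (\<lambda>\<eta>. X *v \<eta>)"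
    by (auto simp: columns_def matrix_vector_mult_basis[symmetric])
  then show "span (columns X) \<subseteq> range (\<lambda>\<eta>. X *v \<eta>)"
    by (rule span_minimal) (metis linear_subspace_image matrix_vector_mul_linear subspace_UNIV)
qed (auto simp: matrix_vector_mult_in_columnspace)

text \<open>The factor is the very one chosen inside \<open>gaussian\<close>. Positive definiteness
  makes its transpose injective, hence the factor invertible.\<close>

lemma gaussian_factor:
  fixes A :: "real^'n^'n"
  assumes "transpose A = A" and "\<And>v. v \<noteq> 0 \<Longrightarrow> 0 < v \<bullet> (A *v v)"
  obtains B :: "real^'n^'n" where "B ** transpose B = A" "invertible B"
    "\<And>\<mu>. gaussian \<mu> A = distr std_gaussian borel (\<lambda>z. \<mu> + B *v z)"
proof -
  define B where "B = (SOME B :: real^'n^'n. B ** transpose B = A)"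
  have "\<exists>B :: real^'n^'n. B ** transpose B = A"
    by (rule psd_factor[OF assms(1)]) (metis assms(2) inner_zero_left order.strict_iff_order order_refl)
  then have B: "B ** transpose B = A" unfolding B_def by (rule someI_ex)
  have "v = 0" if "transpose B *v v = 0" for v
  proof (rule ccontr)
    assume "v \<noteq> 0"
    then show False using assms(2)[of v] norm_transpose_mult[of v B] that by (simp add: B)
  qed
  then have "invertible (transpose B)"
    unfolding invertible_left_inverse matrix_left_invertible_ker by blast
  then have "invertible B" using transpose_invertible[of "transpose B"] by simp
  then show thesis by (rule that[OF B]) (simp add: gaussian_def B_def)
qed

text \<open>Only the forms of D D' are known to converge, while the factors are arbitrary and may
  oscillate. Their row norms are bounded, so compactness supplies a convergent subsequence.\<close>

lemma matrix_subsequence_of_quadform: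
  fixes D :: "nat \<Rightarrow> real^'n^'n"
  assumes lim: "\<And>v. (\<lambda>m. (norm (transpose (D m) *v v))\<^sup>2) \<longlonglongrightarrow> q v"
  obtains s D' where "strict_mono s" "(D \<circ> s) \<longlonglongrightarrow> D'" "\<And>v. (norm (transpose D' *v v))\<^sup>2 = q v"
proof -
  have row: "D m $ i = transpose (D m) *v axis i 1" for m i
    by (simp add: matrix_vector_mult_basis column_def transpose_def vec_eq_iff)
  have "Bseq (\<lambda>m. \<Sum>i\<in>UNIV. sqrt ((norm (transpose (D m) *v axis i 1))\<^sup>2))"
    by (intro convergent_imp_Bseq convergentI[OF tendsto_sum[OF tendsto_real_sqrt[OF lim]]])
  then obtain K where K: "\<And>m. norm (\<Sum>i\<in>UNIV. sqrt ((norm (transpose (D m) *v axis i 1))\<^sup>2)) \<le> K"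
    by (auto simp: Bseq_def)
  have "norm (D m) \<le> K" for m
  proof -
    have "norm (D m) \<le> (\<Sum>i\<in>UNIV. norm (D m $ i))"
      unfolding norm_vec_def[of "D m"] by (rule L2_set_le_sum) simp
    also have "\<dots> \<le> K" using K[of m] unfolding row by simp
    finally show ?thesis .
  qed
  then have "bounded (range D)" by (auto simp: bounded_iff)
  then obtain s D' where s: "strict_mono s" "(D \<circ> s) \<longlonglongrightarrow> D'"
    using bounded_imp_convergent_subsequence by blast
  have "(norm (transpose D' *v v))\<^sup>2 = q v" for v
  proof (rule LIMSEQ_unique)
    show "(\<lambda>m. (norm (transpose ((D \<circ> s) m) *v v))\<^sup>2) \<longlonglongrightarrow> (norm (transpose D' *v v))\<^sup>2"
      by (intro tendsto_intros tendsto_matrix_vector_mult tendsto_transpose s)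
    show "(\<lambda>m. (norm (transpose ((D \<circ> s) m) *v v))\<^sup>2) \<longlonglongrightarrow> q v"
      using LIMSEQ_subseq_LIMSEQ[OF lim[of v] s(1)] by (simp add: comp_def)
  qed
  then show thesis using that s by blast
qed

text \<open>Dominated convergence for the indicators.\<close>

lemma measure_tendsto_1_of_AE:
  assumes "prob_space M" and meas: "\<And>m. A m \<in> sets M"
    and ae: "AE z in M. \<forall>\<^sub>F m in sequentially. z \<in> A m"
  shows "(\<lambda>m. measure M (A m)) \<longlonglongrightarrow> 1"
proof -
  interpret prob_space M by fact
  have "(\<lambda>m. \<integral>z. indicator (A m) z \<partial>M) \<longlonglongrightarrow> (\<integral>z. (1::real) \<partial>M)"
  proof (rule integral_dominated_convergence[where w = "\<lambda>_. 1"])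
    show "AE z in M. (\<lambda>m. indicator (A m) z) \<longlonglongrightarrow> (1::real)"
      using ae
    proof eventually_elim
      case (elim z)
      then show ?case by (intro tendsto_eventually) (auto elim: eventually_mono)
    qed
  qed (use meas in \<open>auto split: split_indicator\<close>)
  then show ?thesis using meas by (simp add: sets.Int_space_eq2 prob_space)
qed

theorem theorem3p6:
  fixes X :: "real^'k^'n::{finite,wellorder}"
    and R :: "real^'k^'q"
    and r :: "real^'q"
    and F :: "(real \<Rightarrow> real) set"
    and bhat :: "real^'n::_ \<Rightarrow> real^'k"
    and Omega :: "real^'n::_ \<Rightarrow> real^'q^'q"
    and S :: "(real^'n::_) set"
    and \<Gamma> :: "real set"
  assumes "CARD('k) < CARD('n)"
    and "rank X = CARD('k)"
    and "rank R = CARD('q)"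
    and "F \<noteq> {}"
    and "F \<subseteq> spectral_densities"
    and "estimator_conditions X bhat Omega {}"
    and "\<And>y x. 0 \<le> x \<bullet> (Omega y *v x)"
    and "\<Gamma> \<in> sing_sets F (null_hyp_lin X R)"
    and "S = span (orth_proj (orthogonal_comp (null_hyp_lin X R)) `
               (\<Union>\<gamma>\<in>\<Gamma>. columns (E_mat (rho \<gamma> (null_hyp_lin X R)) \<gamma>)))"
  shows "(S \<subseteq> span (columns X) \<longleftrightarrow>
            span (\<Union>\<gamma>\<in>\<Gamma>. columns (E_mat (rho \<gamma> (null_hyp_lin X R)) \<gamma>))
              \<subseteq> span (columns X)) \<and>
         (S \<subseteq> span (columns X) \<longrightarrow>
            dim S < CARD('n) - dim (null_hyp_lin X R) \<and>
            (\<forall>C \<sigma>2 :: real. \<forall>\<mu>\<^sub>0 \<in> null_hyp X R r. 0 < \<sigma>2 \<longrightarrow>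
               (SUP f\<in>F. measure (gaussian \<mu>\<^sub>0 (\<sigma>2 *\<^sub>R Sigma_mat f))
                          {y. F_type_stat R r bhat Omega {} y \<ge> C}) = 1))"
proof -
  note est = assms(6) and psd = assms(7)
  define L where "L = null_hyp_lin X R"
  define P where "P = orth_proj (orthogonal_comp L)"
  define E where "E = (\<Union>\<gamma>\<in>\<Gamma>. columns (E_mat (rho \<gamma> L) \<gamma> :: real^2^'n::_))"
  have L: "subspace L" "L \<noteq> UNIV"
    using null_hyp_lin_subspace null_hyp_lin_neq_UNIV[OF assms(1)] by (auto simp: L_def)
  have LX: "L \<subseteq> span (columns X)" unfolding L_def by (rule null_hyp_lin_subset_columns)
  have S: "S = span (P ` E)" using assms(9) by (simp add: L_def P_def E_def)
  have P: "P y \<in> orthogonal_comp L" "y - P y \<in> L" for y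
    unfolding P_def using orth_proj_comp[OF L(1)] by auto
  have linP: "linear P" unfolding P_def by (rule linear_orth_proj_comp[OF L(1)])
  have P_inner: "P x \<bullet> y = x \<bullet> P y" for x y
    unfolding P_def by (rule orth_proj_comp_inner[OF L(1)])
  have P_id: "P v = v" if "v \<in> orthogonal_comp L" for v
    unfolding P_def using that subspace_0[OF subspace_orthogonal_comp]
    by (intro orth_proj_eqI subspace_orthogonal_comp) auto
  have SL: "S \<subseteq> orthogonal_comp L"
    unfolding S by (rule span_minimal[OF _ subspace_orthogonal_comp]) (use P in auto)
  have L_SL: "x = 0" if "x \<in> L" "x \<in> orthogonal_comp L" for x
    using that by (auto simp: orthogonal_comp_def orthogonal_def)

  \<comment> \<open>The projection changes \<open>e\<close> only by an element of \<open>L\<close>,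
    which lies in the column space.\<close>
  have P_iff: "P e \<in> span (columns X) \<longleftrightarrow> e \<in> span (columns X)" for e
  proof -
    have "e - P e \<in> span (columns X)" using P(2) LX by blast
    then show ?thesis by (metis diff_add_cancel span_add span_add_eq)
  qed
  have "S \<subseteq> span (columns X) \<longleftrightarrow> P ` E \<subseteq> span (columns X)"
    unfolding S by (meson span_superset span_minimal subspace_span subset_trans)
  also have "\<dots> \<longleftrightarrow> E \<subseteq> span (columns X)" using P_iff by auto
  also have "\<dots> \<longleftrightarrow> span E \<subseteq> span (columns X)"
    by (meson span_superset span_minimal subspace_span subset_trans)
  finally have iff: "S \<subseteq> span (columns X) \<longleftrightarrow> span E \<subseteq> span (columns X)" .

  have dim_S: "dim S < CARD('n) - dim L" if SX: "S \<subseteq> span (columns X)"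
  proof -
    \<comment> \<open>So the sum of \<open>S\<close> and \<open>L\<close> is direct, and it sits
      inside the column space, whose dimension is below n.\<close>
    have "S \<inter> L = {0}"
      using L_SL SL L(1) by (auto simp: S subspace_0 span_zero)
    then have "dim S + dim L = dim {x + y | x y. x \<in> S \<and> y \<in> L}"
      using dim_sums_Int[of S L] L(1) by (simp add: S)
    also have "\<dots> \<le> dim (span (columns X))"
      using SX LX by (intro dim_subset) (auto intro: span_add)
    also have "\<dots> < CARD('n)" using assms(1,2) by (simp add: column_rank_def)
    finally show ?thesis by simp
  qed

  have sup: "(SUP f\<in>F. measure (gaussian \<mu> (\<sigma>2 *\<^sub>R Sigma_mat f))
                {y. F_type_stat R r bhat Omega {} y \<ge> C}) = 1"
    if SX: "S \<subseteq> span (columns X)" and \<mu>: "\<mu> \<in> null_hyp X R r" and \<sigma>2: "0 < \<sigma>2" for C \<sigma>2 :: real and \<mu>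
  proof -
    define T where "T = F_type_stat R r bhat Omega {}"
    have T [measurable]: "T \<in> borel_measurable borel"
      unfolding T_def by (rule borel_measurable_F_type_stat[OF est])
    define pr where "pr f = measure (gaussian \<mu> (\<sigma>2 *\<^sub>R Sigma_mat f)) {y. T y \<ge> C}" for f
    obtain \<beta>\<^sub>0 where \<beta>\<^sub>0: "\<mu> = X *v \<beta>\<^sub>0" "R *v \<beta>\<^sub>0 = r" using \<mu> by (auto simp: null_hyp_def)
    obtain f c q where fF: "\<And>m :: nat. f m \<in> F" and c: "\<And>m. 0 < (c m :: real)"
      and lim: "\<And>v. v \<in> orthogonal_comp L \<Longrightarrow> (\<lambda>m. v \<bullet> (Sigma_mat (f m) *v v) / c m) \<longlonglongrightarrow> q v"
      and q0: "\<And>v. v \<in> orthogonal_comp L \<Longrightarrow>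
         v \<in> orthogonal_comp E \<Longrightarrow> q v = 0"
      and q_ne: "\<exists>v\<in>orthogonal_comp L. q v \<noteq> 0"
      using spectral_limit[OF L assms(5) assms(8)[folded L_def], folded E_def] by blast
    \<comment> \<open>All the laws are realized on the one space \<open>std_gaussian\<close>, so
      that convergence can be argued for each fixed \<open>z\<close>.\<close>
    have "\<exists>B :: real^'n::_^'n::_. B ** transpose B = \<sigma>2 *\<^sub>R Sigma_mat g \<and> invertible B \<and>
        gaussian \<mu> (\<sigma>2 *\<^sub>R Sigma_mat g) = distr std_gaussian borel (\<lambda>z. \<mu> + B *v z)"
      if "g \<in> F" for g
    proof (rule gaussian_factor)
      have g: "g \<in> spectral_densities" using that assms(5) by blast
      show "transpose (\<sigma>2 *\<^sub>R Sigma_mat g :: real^'n::_^'n::_) = \<sigma>2 *\<^sub>R Sigma_mat g"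
        by (simp add: transpose_scalar transpose_Sigma_mat[OF g])
      show "0 < v \<bullet> ((\<sigma>2 *\<^sub>R Sigma_mat g) *v v)" if "v \<noteq> 0" for v
        using Sigma_mat_pos_def[OF g that] \<sigma>2 by (simp add: scaleR_matrix_vector_assoc[symmetric])
    qed blast
    then obtain B' :: "(real \<Rightarrow> real) \<Rightarrow> real^'n::_^'n::_" where B': "\<And>g. g \<in> F \<Longrightarrow> B' g ** transpose (B' g) = \<sigma>2 *\<^sub>R Sigma_mat g"
      "\<And>g. g \<in> F \<Longrightarrow> invertible (B' g)"
      "\<And>g. g \<in> F \<Longrightarrow> gaussian \<mu> (\<sigma>2 *\<^sub>R Sigma_mat g) = distr std_gaussian borel (\<lambda>z. \<mu> + B' g *v z)"
      by metis
    have aff [measurable]: "(\<lambda>z. \<mu> + B *v z) \<in> borel_measurable borel" for B :: "real^'n::_^'n::_"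
      by (intro borel_measurable_continuous_onI continuous_on_add continuous_on_const
          matrix_vector_mult_linear_continuous_on)
    interpret G: prob_space "std_gaussian :: (real^'n::_) measure" by (rule prob_space_std_gaussian)
    have pr_eq: "pr g = measure std_gaussian {z. T (\<mu> + B' g *v z) \<ge> C}" if "g \<in> F" for g
    proof -
      have "space (std_gaussian :: (real^'n::_) measure) = UNIV" by (simp add: std_gaussian_def)
      then show ?thesis
        unfolding pr_def B'(3)[OF that] by (subst measure_distr) (auto simp: vimage_def)
    qed
    define B where "B m = B' (f m)" for m
    \<comment> \<open>This scale removes \<open>\<sigma>2\<close> and turns the covariance of the
      projected vector into the normalized form treated by \<open>spectral_limit\<close>.\<close>
    define \<delta> where "\<delta> m = 1 / sqrt (\<sigma>2 * c m)" for m
    have \<delta>: "0 < \<delta> m" for m using \<sigma>2 c[of m] by (simp add: \<delta>_def)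
    define D where "D m = matrix (\<lambda>z. \<delta> m *\<^sub>R P (B m *v z))" for m
    have D: "D m *v z = \<delta> m *\<^sub>R P (B m *v z)" for m z
    proof -
      have "linear (\<lambda>z. \<delta> m *\<^sub>R P (B m *v z))"
        using linear_compose[OF matrix_vector_mul_linear[of "B m"] linP]
        by (intro linear_compose_scale_right) (simp add: comp_def)
      then show ?thesis unfolding D_def by simp
    qed
    have DT: "transpose (D m) *v v = \<delta> m *\<^sub>R (transpose (B m) *v P v)" for m v
    proof -
      have "z \<bullet> (transpose (D m) *v v) = z \<bullet> (\<delta> m *\<^sub>R (transpose (B m) *v P v))" for z
      proof -
        have "z \<bullet> (transpose (D m) *v v) = (D m *v z) \<bullet> v"
          by (metis dot_lmul_matrix inner_commute transpose_matrix_vector)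
        also have "\<dots> = \<delta> m * ((B m *v z) \<bullet> P v)" by (simp add: D P_inner)
        also have "(B m *v z) \<bullet> P v = z \<bullet> (transpose (B m) *v P v)"
          by (metis dot_lmul_matrix inner_commute transpose_matrix_vector)
        finally show ?thesis by simp
      qed
      then show ?thesis using vector_eq_ldot by blast
    qed
    have quad: "(norm (transpose (D m) *v v))\<^sup>2 = P v \<bullet> (Sigma_mat (f m) *v P v) / c m" for m v
    proof -
      have "(norm (transpose (D m) *v v))\<^sup>2 = (\<delta> m)\<^sup>2 * (P v \<bullet> ((\<sigma>2 *\<^sub>R Sigma_mat (f m)) *v P v))"
        unfolding DT B'(1)[OF fF, symmetric] B_def norm_transpose_mult by (simp add: power_mult_distrib)
      also have "\<dots> = P v \<bullet> (Sigma_mat (f m) *v P v) / c m"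
        using \<sigma>2 c[of m]
        by (simp add: \<delta>_def power_divide scaleR_matrix_vector_assoc[symmetric])
      finally show ?thesis .
    qed
    have "(\<lambda>m. (norm (transpose (D m) *v v))\<^sup>2) \<longlonglongrightarrow> q (P v)" for v
      unfolding quad by (rule lim[OF P(1)])
    then obtain s D' where s: "strict_mono s" "(D \<circ> s) \<longlonglongrightarrow> D'"
      and D'q: "\<And>v. (norm (transpose D' *v v))\<^sup>2 = q (P v)"
      using matrix_subsequence_of_quadform[of D "\<lambda>v. q (P v)"] by blast
    \<comment> \<open>By duality: \<open>q\<close> vanishes at the projection of any vector
      orthogonal to \<open>S\<close>, so \<open>transpose D'\<close> kills the complement of
      \<open>S\<close>.\<close>
    have D'_range: "D' *v z \<in> S" for z
    proof -
      have "D' *v z \<in> orthogonal_comp (orthogonal_comp S)"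
      proof -
        have "(D' *v z) \<bullet> v = 0" if v: "v \<in> orthogonal_comp S" for v
        proof -
          have "x \<bullet> P v = 0" if "x \<in> E" for x
          proof -
            have "P x \<in> S" using that by (simp add: S span_base)
            then show ?thesis using v by (simp add: P_inner[symmetric] orthogonal_comp_def orthogonal_def)
          qed
          then have "q (P v) = 0" by (intro q0 P) (simp add: orthogonal_comp_def orthogonal_def)
          then have "transpose D' *v v = 0" using D'q[of v] by simp
          then show ?thesis by (metis dot_lmul_matrix inner_commute inner_zero_right transpose_matrix_vector)
        qed
        then show ?thesis by (simp add: orthogonal_comp_def orthogonal_def inner_commute)
      qed
      then show ?thesis using orthogonal_comp_self[of S] by (simp add: S)
    qed
    have "D' \<noteq> 0"
    proof
      assume "D' = 0"
      obtain v where v: "v \<in> orthogonal_comp L" "q v \<noteq> 0" using q_ne by blast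
      have "transpose D' = 0" using \<open>D' = 0\<close> by (simp add: vec_eq_iff transpose_def)
      then show False using D'q[of v] v by (simp add: P_id)
    qed
    have "AE z in std_gaussian. \<mu> + B m *v z \<notin> {y. det (Omega y) = 0}" for m
    proof (rule AE_std_gaussian_affine)
      show "invertible (B m)" unfolding B_def by (rule B'(2)[OF fF])
      have "continuous_on UNIV (\<lambda>y. det (Omega y))"
        using est by (intro continuous_on_det continuous_intros) (auto simp: estimator_conditions_def)
      then show "closed {y. det (Omega y) = 0}"
        using closed_Collect_eq continuous_on_const by blast
      show "AE y in lborel. y \<notin> {y. det (Omega y) = 0}"
        using est by (simp add: estimator_conditions_def invertible_det_nz)
    qed
    then have "AE z in std_gaussian. \<forall>m. det (Omega (\<mu> + B m *v z)) \<noteq> 0"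
      by (simp add: AE_all_countable)
    moreover have "AE z in std_gaussian. D' *v z \<noteq> 0"
      by (rule AE_std_gaussian_mult_ne_0) fact
    ultimately have "AE z in std_gaussian. \<forall>\<^sub>F m in sequentially. z \<in> {z. T (\<mu> + B (s m) *v z) \<ge> C}"
    proof eventually_elim
      case (elim z)
      obtain \<eta> where \<eta>: "D' *v z = X *v \<eta>" using D'_range[of z] SX by (auto simp: span_columns_range)
      \<comment> \<open>Otherwise the nonzero limit would lie both in \<open>L\<close> and in its
        orthogonal complement.\<close>
      have "R *v \<eta> \<noteq> 0"
      proof
        assume "R *v \<eta> = 0"
        then have "X *v \<eta> \<in> L" by (auto simp: L_def null_hyp_lin_def)
        moreover have "X *v \<eta> \<in> orthogonal_comp L" using D'_range[of z] SL \<eta> by auto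
        ultimately show False using L_SL elim \<eta> by auto
      qed
      have "\<exists>\<alpha>. B m *v z - P (B m *v z) = X *v \<alpha> \<and> R *v \<alpha> = 0" for m
        using P(2)[of "B m *v z"] by (auto simp: L_def null_hyp_lin_def)
      then obtain \<alpha> where \<alpha>: "\<And>m. B m *v z - P (B m *v z) = X *v \<alpha> m" "\<And>m. R *v \<alpha> m = 0" by metis
      \<comment> \<open>The first term recenters the rescaled vector at \<open>\<mu>\<close>; the
        second cancels its component in \<open>L\<close>. What remains is
        \<open>\<mu> + D m *v z\<close>.\<close>
      define \<zeta> where "\<zeta> m = (1 - \<delta> m) *\<^sub>R \<beta>\<^sub>0 - \<delta> m *\<^sub>R \<alpha> m" for m
      have R\<zeta>: "R *v \<zeta> m = (1 - \<delta> m) *\<^sub>R r" for m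
        by (simp add: \<zeta>_def matrix_vector_mult_diff_distrib matrix_vector_mult_scaleR \<alpha> \<beta>\<^sub>0)
      have "\<delta> m *\<^sub>R (\<mu> + B m *v z) + X *v \<zeta> m = \<mu> + D m *v z" for m
        by (simp add: \<zeta>_def matrix_vector_mult_diff_distrib matrix_vector_mult_scaleR
            \<alpha>(1)[symmetric] \<beta>\<^sub>0(1)[symmetric] D algebra_simps)
      then have "(\<lambda>m. \<delta> (s m) *\<^sub>R (\<mu> + B (s m) *v z) + X *v \<zeta> (s m)) = (\<lambda>m. \<mu> + (D \<circ> s) m *v z)"
        by simp
      moreover have "(\<lambda>m. \<mu> + (D \<circ> s) m *v z) \<longlonglongrightarrow> \<mu> + D' *v z"
        by (intro tendsto_intros tendsto_matrix_vector_mult s)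
      moreover have "\<mu> + D' *v z = X *v (\<beta>\<^sub>0 + \<eta>)"
        by (simp add: \<beta>\<^sub>0 \<eta> matrix_vector_right_distrib)
      ultimately have "(\<lambda>m. \<delta> (s m) *\<^sub>R (\<mu> + B (s m) *v z) + X *v \<zeta> (s m)) \<longlonglongrightarrow> X *v (\<beta>\<^sub>0 + \<eta>)"
        by simp
      moreover have "R *v (\<beta>\<^sub>0 + \<eta>) \<noteq> r"
        using \<open>R *v \<eta> \<noteq> 0\<close> by (simp add: matrix_vector_right_distrib \<beta>\<^sub>0)
      ultimately have "\<forall>\<^sub>F m in sequentially. C \<le> F_type_stat R r bhat Omega {} (\<mu> + B (s m) *v z)"
        using \<delta> R\<zeta> elim(1)
        by (intro eventually_F_type_stat_ge[OF est psd, where \<delta> = "\<lambda>m. \<delta> (s m)" and \<zeta> = "\<lambda>m. \<zeta> (s m)"])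
           (auto simp: less_imp_neq[symmetric])
      then show ?case by (simp add: T_def)
    qed
    then have "(\<lambda>m. measure std_gaussian {z. T (\<mu> + B (s m) *v z) \<ge> C}) \<longlonglongrightarrow> 1"
      by (intro measure_tendsto_1_of_AE prob_space_std_gaussian) simp_all
    then have pr_lim: "(\<lambda>m. pr (f (s m))) \<longlonglongrightarrow> 1"
      by (simp add: pr_eq[OF fF] B_def)
    have le1: "pr g \<le> 1" if "g \<in> F" for g
      unfolding pr_eq[OF that] by (rule G.prob_le_1)
    have "bdd_above (pr ` F)" using le1 by (auto simp: bdd_above_def)
    then have "pr (f m) \<le> (SUP g\<in>F. pr g)" for m by (rule cSUP_upper[OF fF])
    then have "1 \<le> (SUP g\<in>F. pr g)" using LIMSEQ_le_const2[OF pr_lim] by blast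
    moreover have "(SUP g\<in>F. pr g) \<le> 1" using assms(4) le1 by (rule cSUP_least)
    ultimately show ?thesis by (simp add: pr_def T_def)
  qed
  show ?thesis
    using iff dim_S sup by (simp add: L_def E_def)
qed

end
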